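(* Let $T$ be an aperiodic Borel automorphism of an uncountable standard Borel space $(X,\mathcal B)$. Then there exist an ordered Borel-Bratteli diagram $B=(V,E,\ge)$ and the associated Vershik automorphism $\varphi:Y_B\to Y_B$ such that $(X,T)$ is (Borel) isomorphic to $(Y_B,\varphi)$.
   Context: $T$ is aperiodic if all its orbits are infinite. A Borel-Bratteli diagram is an infinite graph $B=(V,E)$ with partitions $V=\bigcup_{i\ge0}V_i$, $E=\bigcup_{i\ge1}E_i$ such that: (i) $V_0=\{v_0\}$ is a single point and every $V_i$ and $E_i$ is at most countable; (ii) there are maps $r,s:E\to V$ (range and source) with $r(E_i)\subset V_i$, $s(E_i)\subset V_{i-1}$, $s^{-1}(v)\ne\emptyset$ for all $v\in V$ and $r^{-1}(v)\neq\emptyset$ for all $v\in V\setminus V_0$; (iii) $r^{-1}(v)$ is finite for every $v\in V\setminus V_0$. An infinite path is a sequence $(e_1,e_2,\dots)$ with $e_i\in E_i$ and $s(e_{i+1})=r(e_i)$; $Y_B$ is the set of infinite paths, a $0$-dimensional Polish space with the topology generated by the clopen cylinder sets (paths with a prescribed finite initial segment), and with the corresponding Borel structure. An ordered Borel-Bratteli diagram $B=(V,E,\ge)$ is a Borel-Bratteli diagram with a partial order on $E$ such that $e,e'$ are comparable iff $r(e)=r(e')$ (so each finite set $r^{-1}(v)$ is linearly ordered), and such that $Y_B$ has no cofinal maximal or minimal paths: there is no $(e_i)\in Y_B$ for which $e_i$ is maximal in $r^{-1}(r(e_i))$ for all sufficiently large $i$, and none for which $e_i$ is minimal in $r^{-1}(r(e_i))$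 for all sufficiently large $i$. The Vershik automorphism $\varphi$: for $y=(e_1,e_2,\dots)\in Y_B$ let $k$ be the least index with $e_k$ not maximal in $r^{-1}(r(e_k))$, let $f_k$ be the successor of $e_k$ in $r^{-1}(r(e_k))$, and let $(f_1,\dots,f_{k-1})$ be the unique path from $v_0$ to $s(f_k)$ all of whose edges are minimal; then $\varphi(y)=(f_1,\dots,f_{k-1},f_k,e_{k+1},e_{k+2},\dots)$. This is a homeomorphism of $Y_B$ onto itself. *)

theory Defs
  imports "HOL-Analysis.Analysis"
begin

text \<open>Measurable spaces are rendered as the library's type \<open>'a measure\<close>, of which only
  \<^const>\<open>space\<close> and \<^const>\<open>sets\<close> matter; the measure itself plays no role.\<close>

definition borel_of :: "'a topology \<Rightarrow> 'a measure" where
  "borel_of S = sigma (topspace S) {U. openin S U}"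

definition polish_space :: "'a topology \<Rightarrow> bool" where
  "polish_space S \<longleftrightarrow> completely_metrizable_space S \<and> separable_space S"

definition standard_borel_space :: "'a measure \<Rightarrow> bool" where
  "standard_borel_space M \<longleftrightarrow>
     (\<exists>S. polish_space S \<and> topspace S = space M \<and> sets (borel_of S) = sets M)"

definition borel_isomorphism :: "'a measure \<Rightarrow> 'b measure \<Rightarrow> ('a \<Rightarrow> 'b) \<Rightarrow> bool" where
  "borel_isomorphism M N f \<longleftrightarrow>
     bij_betw f (space M) (space N) \<and> f \<in> M \<rightarrow>\<^sub>M N \<and> the_inv_into (space M) f \<in> N \<rightarrow>\<^sub>M M"

definition borel_automorphism :: "'a measure \<Rightarrow> ('a \<Rightarrow> 'a) \<Rightarrow> bool" where
  "borel_automorphism M T \<longleftrightarrow> borel_isomorphism M M T"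

definition full_orbit :: "'a set \<Rightarrow> ('a \<Rightarrow> 'a) \<Rightarrow> 'a \<Rightarrow> 'a set" where
  "full_orbit X T x =
     range (\<lambda>n::nat. (T ^^ n) x) \<union> range (\<lambda>n::nat. (the_inv_into X T ^^ n) x)"

definition aperiodic :: "'a set \<Rightarrow> ('a \<Rightarrow> 'a) \<Rightarrow> bool" where
  "aperiodic X T \<longleftrightarrow> (\<forall>x\<in>X. infinite (full_orbit X T x))"

definition isomorphic_systems ::
    "'a measure \<Rightarrow> ('a \<Rightarrow> 'a) \<Rightarrow> 'b measure \<Rightarrow> ('b \<Rightarrow> 'b) \<Rightarrow> bool" where
  "isomorphic_systems M T N S \<longleftrightarrow>
     (\<exists>h. borel_isomorphism M N h \<and> (\<forall>x\<in>space M. h (T x) = S (h x)))"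

text \<open>Only the values \<open>edge_level B i\<close> with \<open>i \<ge> 1\<close> belong to the diagram. A pair \<open>(e, e')\<close> in
  \<open>edge_order B\<close> means that \<open>e\<close> is below or equal to \<open>e'\<close>.\<close>

record ('v, 'e) diagram =
  vertex_level :: "nat \<Rightarrow> 'v set"
  edge_level :: "nat \<Rightarrow> 'e set"
  src :: "'e \<Rightarrow> 'v"
  rng :: "'e \<Rightarrow> 'v"

record ('v, 'e) ordered_diagram = "('v, 'e) diagram" +
  edge_order :: "'e rel"

definition vertices :: "('v, 'e, 'z) diagram_scheme \<Rightarrow> 'v set" where
  "vertices B = (\<Union>i. vertex_level B i)"

definition edges :: "('v, 'e, 'z) diagram_scheme \<Rightarrow> 'e set" where
  "edges B = (\<Union>i\<in>{1..}. edge_level B i)"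

definition edges_from :: "('v, 'e, 'z) diagram_scheme \<Rightarrow> 'v \<Rightarrow> 'e set" where
  "edges_from B v = {e \<in> edges B. src B e = v}"

definition edges_into :: "('v, 'e, 'z) diagram_scheme \<Rightarrow> 'v \<Rightarrow> 'e set" where
  "edges_into B v = {e \<in> edges B. rng B e = v}"

definition borel_bratteli_diagram :: "('v, 'e, 'z) diagram_scheme \<Rightarrow> bool" where
  "borel_bratteli_diagram B \<longleftrightarrow>
     disjoint_family (vertex_level B) \<and>
     disjoint_family_on (edge_level B) {1..} \<and>
     (\<exists>v0. vertex_level B 0 = {v0}) \<and>
     (\<forall>i. countable (vertex_level B i)) \<and>
     (\<forall>i\<ge>1. countable (edge_level B i)) \<and>
     (\<forall>i\<ge>1. rng B ` edge_level B i \<subseteq> vertex_level B i) \<and>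
     (\<forall>i\<ge>1. src B ` edge_level B i \<subseteq> vertex_level B (i - 1)) \<and>
     (\<forall>v\<in>vertices B. edges_from B v \<noteq> {}) \<and>
     (\<forall>v\<in>vertices B - vertex_level B 0. edges_into B v \<noteq> {}) \<and>
     (\<forall>v\<in>vertices B - vertex_level B 0. finite (edges_into B v))"

text \<open>A path \<open>(e\<^sub>1, e\<^sub>2, \<dots>)\<close> is the function \<open>y\<close> with \<open>y i = e\<^sub>i\<^sub>+\<^sub>1\<close>: indices are shifted by one.
  The same shift applies to the entries of the lists representing finite paths.\<close>

definition path_space :: "('v, 'e, 'z) diagram_scheme \<Rightarrow> (nat \<Rightarrow> 'e) set" where
  "path_space B =
     {y. (\<forall>i. y i \<in> edge_level B (Suc i)) \<and> (\<forall>i. src B (y (Suc i)) = rng B (y i))}"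

definition cylinder :: "('v, 'e, 'z) diagram_scheme \<Rightarrow> 'e list \<Rightarrow> (nat \<Rightarrow> 'e) set" where
  "cylinder B p = {y \<in> path_space B. \<forall>i<length p. y i = p ! i}"

definition path_topology :: "('v, 'e, 'z) diagram_scheme \<Rightarrow> (nat \<Rightarrow> 'e) topology" where
  "path_topology B = topology_generated_by (range (cylinder B))"

definition maximal_edge :: "('v, 'e, 'z) ordered_diagram_scheme \<Rightarrow> 'e \<Rightarrow> bool" where
  "maximal_edge B e \<longleftrightarrow>
     (\<forall>e' \<in> edges_into B (rng B e). (e, e') \<in> edge_order B \<longrightarrow> e' = e)"

definition minimal_edge :: "('v, 'e, 'z) ordered_diagram_scheme \<Rightarrow> 'e \<Rightarrow> bool" where
  "minimal_edge B e \<longleftrightarrow>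
     (\<forall>e' \<in> edges_into B (rng B e). (e', e) \<in> edge_order B \<longrightarrow> e' = e)"

definition ordered_borel_bratteli_diagram ::
    "('v, 'e, 'z) ordered_diagram_scheme \<Rightarrow> bool" where
  "ordered_borel_bratteli_diagram B \<longleftrightarrow>
     borel_bratteli_diagram B \<and>
     partial_order_on (edges B) (edge_order B) \<and>
     (\<forall>e\<in>edges B. \<forall>e'\<in>edges B.
        ((e, e') \<in> edge_order B \<or> (e', e) \<in> edge_order B) \<longleftrightarrow> rng B e = rng B e') \<and>
     (\<nexists>y. y \<in> path_space B \<and> (\<exists>n. \<forall>i\<ge>n. maximal_edge B (y i))) \<and>
     (\<nexists>y. y \<in> path_space B \<and> (\<exists>n. \<forall>i\<ge>n. minimal_edge B (y i)))"

definition edge_successor :: "('v, 'e, 'z) ordered_diagram_scheme \<Rightarrow> 'e \<Rightarrow> 'e" where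
  "edge_successor B e =
     (THE f. f \<in> edges_into B (rng B e) \<and> (e, f) \<in> edge_order B \<and> f \<noteq> e \<and>
        (\<forall>g \<in> edges_into B (rng B e). (e, g) \<in> edge_order B \<and> g \<noteq> e \<longrightarrow> (f, g) \<in> edge_order B))"

definition path_from_root :: "('v, 'e, 'z) diagram_scheme \<Rightarrow> 'e list \<Rightarrow> 'v \<Rightarrow> bool" where
  "path_from_root B p v \<longleftrightarrow>
     (\<forall>i<length p. p ! i \<in> edge_level B (Suc i)) \<and>
     (\<forall>i. Suc i < length p \<longrightarrow> src B (p ! Suc i) = rng B (p ! i)) \<and>
     (if p = [] then v \<in> vertex_level B 0 else rng B (last p) = v)"

definition minimal_path :: "('v, 'e, 'z) ordered_diagram_scheme \<Rightarrow> 'v \<Rightarrow> 'e list" where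
  "minimal_path B v = (THE p. path_from_root B p v \<and> (\<forall>e\<in>set p. minimal_edge B e))"

text \<open>Because of the index shift, \<open>k\<close> below is one less than the index of the first non-maximal
  edge \<open>e\<^sub>k\<close> in the usual one-based description.\<close>

definition vershik :: "('v, 'e, 'z) ordered_diagram_scheme \<Rightarrow> (nat \<Rightarrow> 'e) \<Rightarrow> nat \<Rightarrow> 'e" where
  "vershik B y =
     (let k = (LEAST k. \<not> maximal_edge B (y k));
          f = edge_successor B (y k);
          p = minimal_path B (src B f)
      in (\<lambda>i. if i < k then p ! i else if i = k then f else y i))"

end

theory Submission
  imports Defs
begin

text \<open>There are Borel markers \<open>A 0 \<supseteq> A 1 \<supseteq> \<dots>\<close> with empty intersection, starting with the whole space, such
  that every orbit visits each \<open>A n\<close> infinitely often in both directions. The return times to \<open>A n\<close>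
  cut the space into towers. A vertex at level \<open>n\<close> is a tower over \<open>A n\<close> together with the
  first \<open>n\<close> coordinates of a code of the points on each of its floors; an edge records how a tower
  over \<open>A n\<close> sits in a tower over \<open>A (Suc n)\<close>. Since the return times are finite, every vertex
  receives finitely many edges, ordered by height. On itineraries of points, \<open>T\<close> acts as the Vershik
  map, and a cofinal maximal (minimal) path would yield a point in all the \<open>A n\<close>.

  The point is that every path has to be the itinerary of a point. To this end the code is chosen
  such that the set of codes is closed in Baire space and the automorphism acts continuously on it.
  Every Borel set is built from closed ones by countable unions and complements; recording for
  countably many Borel sets which member of each union involved contains the given point turns all
  of them into clopen sets without destroying completeness.\<close>

section \<open>Towers over markers\<close>

text \<open>In a compact setting every compatible sequence of finite data is realized. Here there
  may be infinitely many towers of unbounded height, so a compatible sequence of vertices and edges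
  could describe no point at all. Completeness of the code alone does not exclude this: a vertex
  records the code on all floors, so the limit point must also have the right codes at finitely many
  translates, whence the continuity assumption \<open>code_act\<close>. The markers enter the code
  (\<open>code_A\<close>), so that return times are governed by finitely many code values. Taking
  \<open>A 0\<close> to be the whole space and \<open>c 0\<close> constant gives a single root.
  Forward and backward recurrence of the markers come from two separate constructions. Their limit
  sets meet each orbit at most once, so aperiodicity allows these points to be discarded without
  losing recurrence. In the construction of the code an ideal point is a consistent system of truth
  values. Consistency of pairs is enough, because the metric arguments compare only two sets at a
  time.\<close>

locale marked_coding =
  fixes X :: "'a set" and act :: "int \<Rightarrow> 'a \<Rightarrow> 'a" and A :: "nat \<Rightarrow> 'a set"
    and c :: "nat \<Rightarrow> 'a \<Rightarrow> nat"
  assumes act_0: "x \<in> X \<Longrightarrow> act 0 x = x"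
    and act_add: "x \<in> X \<Longrightarrow> act i (act j x) = act (i + j) x"
    and act_in: "x \<in> X \<Longrightarrow> act i x \<in> X"
    and A_0: "A 0 = X"
    and A_decseq: "decseq A"
    and A_vanish: "(\<Inter>n. A n) = {}"
    and recurrent_forward: "x \<in> X \<Longrightarrow> \<exists>k\<ge>1. act (int k) x \<in> A n"
    and recurrent_backward: "x \<in> X \<Longrightarrow> \<exists>k. act (- int k) x \<in> A n"
    and code_0: "\<lbrakk>x \<in> X; y \<in> X\<rbrakk> \<Longrightarrow> c 0 x = c 0 y"
    and code_Suc: "\<lbrakk>x \<in> X; y \<in> X; c (Suc n) x = c (Suc n) y\<rbrakk> \<Longrightarrow> c n x = c n y"
    and code_A: "\<lbrakk>x \<in> X; y \<in> X; c n x = c n y\<rbrakk> \<Longrightarrow> x \<in> A n \<longleftrightarrow> y \<in> A n"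
    and code_act: "x \<in> X \<Longrightarrow> \<exists>m. \<forall>z\<in>X. c m z = c m x \<longrightarrow> c n (act i z) = c n (act i x)"
    and code_complete:
      "\<lbrakk>\<And>m. xs m \<in> X; \<And>m n. n \<le> m \<Longrightarrow> c n (xs m) = c n (xs n)\<rbrakk>
         \<Longrightarrow> \<exists>x\<in>X. \<forall>n. c n x = c n (xs n)"
    and code_inj: "\<lbrakk>x \<in> X; y \<in> X; \<And>n. c n x = c n y\<rbrakk> \<Longrightarrow> x = y"
begin

lemma A_antimono: "m \<le> n \<Longrightarrow> A n \<subseteq> A m"
  using A_decseq by (simp add: antimono_def)

lemma A_subset: "A n \<subseteq> X"
  using A_antimono[of 0 n] A_0 by simp

lemma code_mono: "\<lbrakk>m \<le> n; x \<in> X; y \<in> X; c n x = c n y\<rbrakk> \<Longrightarrow> c m x = c m y"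
  by (induction n rule: dec_induct) (auto dest: code_Suc)

text \<open>Time 0 counts backwards but not forwards, so a point of \<open>A n\<close> is the bottom
  floor of its tower, \<open>bwd n x\<close> is the floor of x, and \<open>bwd n x + fwd n x\<close>
  is the height of the tower.\<close>

definition bwd :: "nat \<Rightarrow> 'a \<Rightarrow> nat" where
  "bwd n x = (LEAST j. act (- int j) x \<in> A n)"

definition fwd :: "nat \<Rightarrow> 'a \<Rightarrow> nat" where
  "fwd n x = (LEAST j. j \<ge> 1 \<and> act (int j) x \<in> A n)"

lemma act_bwd: "x \<in> X \<Longrightarrow> act (- int (bwd n x)) x \<in> A n"
  unfolding bwd_def by (rule LeastI_ex, rule recurrent_backward)

lemma act_fwd: "x \<in> X \<Longrightarrow> act (int (fwd n x)) x \<in> A n"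
  and fwd_ge_1: "x \<in> X \<Longrightarrow> fwd n x \<ge> 1"
proof -
  assume x: "x \<in> X"
  have "fwd n x \<ge> 1 \<and> act (int (fwd n x)) x \<in> A n"
    unfolding fwd_def by (rule LeastI_ex) (use recurrent_forward[OF x] in auto)
  then show "act (int (fwd n x)) x \<in> A n" "fwd n x \<ge> 1" by auto
qed

lemma no_visit_between:
  assumes "x \<in> X" "- int (bwd n x) < k" "k < int (fwd n x)"
  shows "act k x \<notin> A n"
proof (cases "k \<ge> 1")
  case True
  show ?thesis
  proof
    assume "act k x \<in> A n"
    then have "fwd n x \<le> nat k" unfolding fwd_def using True by (intro Least_le) auto
    with assms True show False by linarith
  qed
next
  case False
  show ?thesis
  proof
    assume "act k x \<in> A n"
    then have "bwd n x \<le> nat (- k)" unfolding bwd_def using False by (intro Least_le) auto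
    with assms False show False by linarith
  qed
qed

lemma bwd_fwd_unique:
  assumes x: "x \<in> X" and p: "act (- int p) x \<in> A n" and f: "act (int f) x \<in> A n" "f \<ge> 1"
    and none: "\<And>k. \<lbrakk>- int p < k; k < int f\<rbrakk> \<Longrightarrow> act k x \<notin> A n"
  shows "bwd n x = p" "fwd n x = f"
proof -
  have "bwd n x \<le> p" unfolding bwd_def by (rule Least_le) (rule p)
  moreover have "\<not> bwd n x < p"
    using none[of "- int (bwd n x)"] act_bwd[OF x, of n] f by linarith
  ultimately show "bwd n x = p" by simp
  have "fwd n x \<le> f" unfolding fwd_def by (rule Least_le) (use f in auto)
  moreover have "\<not> fwd n x < f"
    using none[of "int (fwd n x)"] act_fwd[OF x, of n] fwd_ge_1[OF x, of n] by linarith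
  ultimately show "fwd n x = f" by simp
qed

lemma bwd_mono: assumes "x \<in> X" "m \<le> n" shows "bwd m x \<le> bwd n x"
  unfolding bwd_def[of m] by (rule Least_le) (use act_bwd[of x n] A_antimono[of m n] assms in auto)

lemma fwd_mono: assumes "x \<in> X" "m \<le> n" shows "fwd m x \<le> fwd n x"
  unfolding fwd_def[of m]
  by (rule Least_le) (use act_fwd[of x n] fwd_ge_1[of x n] A_antimono[of m n] assms in auto)

lemma fwd_0: "x \<in> X \<Longrightarrow> fwd 0 x = 1"
  using bwd_fwd_unique[of x 0 0 1] by (auto simp: A_0 act_in)

lemma bwd_eq_0: "x \<in> A n \<Longrightarrow> bwd n x = 0"
  unfolding bwd_def using A_subset[of n] by (intro Least_equality) (auto simp: act_0 subset_eq)

lemma bwd_fwd_act: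
  assumes x: "x \<in> X" and k: "- int (bwd n x) \<le> k" "k < int (fwd n x)"
  shows "int (bwd n (act k x)) = int (bwd n x) + k"
    and "int (fwd n (act k x)) = int (fwd n x) - k"
proof -
  let ?p = "nat (int (bwd n x) + k)" and ?f = "nat (int (fwd n x) - k)"
  have *: "bwd n (act k x) = ?p" "fwd n (act k x) = ?f"
    by (rule bwd_fwd_unique[of "act k x" ?p _ ?f],
        use k x act_bwd[OF x] act_fwd[OF x] no_visit_between[OF x] in
          \<open>auto simp: act_in act_add\<close>)+
  show "int (bwd n (act k x)) = int (bwd n x) + k"
    and "int (fwd n (act k x)) = int (fwd n x) - k"
    using k unfolding * by auto
qed

text \<open>Floors are numbered from the bottom, so the list is the same for all points of an orbit
  segment between two visits, and its length is the height of the tower.\<close>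

definition block :: "nat \<Rightarrow> 'a \<Rightarrow> nat list" where
  "block n x = map (\<lambda>i. c n (act (int i - int (bwd n x)) x)) [0..<bwd n x + fwd n x]"

lemma block_act:
  assumes x: "x \<in> X" and k: "- int (bwd n x) \<le> k" "k < int (fwd n x)"
  shows "block n (act k x) = block n x"
proof -
  have "bwd n (act k x) + fwd n (act k x) = bwd n x + fwd n x"
    using bwd_fwd_act[OF assms] by linarith
  moreover have "act (int i - int (bwd n (act k x))) (act k x) = act (int i - int (bwd n x)) x" for i
    using bwd_fwd_act(1)[OF assms] x by (simp add: act_add)
  ultimately show ?thesis
    by (simp add: block_def)
qed

text \<open>Two points with the same state at level \<open>n\<close> lie on the same floor of the same tower
  over \<open>A n\<close>.\<close>

definition state :: "nat \<Rightarrow> 'a \<Rightarrow> nat list \<times> nat" where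
  "state n x = (block n x, bwd n x)"

text \<open>By \<open>code_A\<close> the codes along the floors locate the visits to
  \<open>A n\<close>. The next visit lies just above the top floor, where nothing is recorded; it is
  therefore a separate hypothesis.\<close>

lemma state_eqI:
  assumes x: "x \<in> X" and y: "y \<in> X" and f: "act (int (fwd n x)) y \<in> A n"
    and eq: "\<And>k. \<lbrakk>- int (bwd n x) \<le> k; k < int (fwd n x)\<rbrakk> \<Longrightarrow> c n (act k y) = c n (act k x)"
  shows "state n y = state n x" "fwd n y = fwd n x"
proof -
  have A: "act k y \<in> A n \<longleftrightarrow> act k x \<in> A n" if "- int (bwd n x) \<le> k" "k < int (fwd n x)" for k
    using code_A[OF _ _ eq[OF that]] x y act_in by blast
  have "bwd n y = bwd n x \<and> fwd n y = fwd n x"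
    using bwd_fwd_unique[OF y, of "bwd n x" n "fwd n x"] A f fwd_ge_1[OF x] act_bwd[OF x]
      no_visit_between[OF x] by (smt (verit) of_nat_0_le_iff of_nat_1 of_nat_mono)
  moreover from this show "fwd n y = fwd n x" by simp
  ultimately show "state n y = state n x"
    using eq by (auto simp: state_def block_def)
qed

lemma length_block: "length (block n x) = bwd n x + fwd n x"
  by (simp add: block_def)

lemma state_eqD:
  assumes x: "x \<in> X" and y: "y \<in> X" and st: "state n y = state n x"
  shows "bwd n y = bwd n x" "fwd n y = fwd n x" "block n y = block n x"
    and "\<lbrakk>- int (bwd n x) \<le> k; k < int (fwd n x)\<rbrakk> \<Longrightarrow> c n (act k y) = c n (act k x)"
proof -
  show b: "bwd n y = bwd n x" and bl: "block n y = block n x"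
    using st by (auto simp: state_def)
  show f: "fwd n y = fwd n x" using b bl length_block[of n x] length_block[of n y] by simp
  assume k: "- int (bwd n x) \<le> k" "k < int (fwd n x)"
  define i where "i = nat (k + int (bwd n x))"
  have "i < bwd n x + fwd n x" "int i - int (bwd n x) = k" using k by (auto simp: i_def)
  with b f have "block n y ! i = c n (act k y)" "block n x ! i = c n (act k x)"
    by (auto simp: block_def)
  with bl show "c n (act k y) = c n (act k x)" by simp
qed

text \<open>The floors of the tower over \<open>A m\<close> are among those of the tower over
  \<open>A n\<close>, and \<open>c n\<close> refines \<open>c m\<close>. Only the return point may
  escape the record.\<close>

lemma state_mono:
  assumes "m \<le> n" and x: "x \<in> X" and y: "y \<in> X" and st: "state n y = state n x"
  shows "state m y = state m x"
proof (rule state_eqI[OF x y])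
  note D = state_eqD[OF x y st]
  have le: "bwd m x \<le> bwd n x" "fwd m x \<le> fwd n x"
    using bwd_mono fwd_mono x assms(1) by auto
  show ceq: "c m (act k y) = c m (act k x)" if "- int (bwd m x) \<le> k" "k < int (fwd m x)" for k
    using that le D(4)[of k] by (intro code_mono[OF assms(1)]) (auto simp: x y act_in)
  show "act (int (fwd m x)) y \<in> A m"
  \<comment> \<open>If both towers end together, the return point is not on a recorded floor; it
    then lies in \<open>A n\<close> because y has the same return time to \<open>A n\<close> as
    x.\<close>
  proof (cases "fwd m x = fwd n x")
    case True
    then show ?thesis using act_fwd[OF y, of n] D(2) A_antimono[OF assms(1)] by auto
  next
    case False
    then have "c n (act (int (fwd m x)) y) = c n (act (int (fwd m x)) x)"
      using le by (intro D(4)) auto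
    then have "c m (act (int (fwd m x)) y) = c m (act (int (fwd m x)) x)"
      by (intro code_mono[OF assms(1)]) (auto simp: x y act_in)
    then show ?thesis using code_A act_fwd[OF x] x y act_in by blast
  qed
qed

lemma state_code:
  assumes "x \<in> X" "y \<in> X" "state n y = state n x"
  shows "c n y = c n x"
  using state_eqD(4)[OF assms, of 0] assms fwd_ge_1[of x n] by (simp add: act_0)

text \<open>The limit point comes from completeness of the code. Its state at level n involves
  \<open>c n\<close> at finitely many translates only, and by \<open>code_act\<close> these values
  are shared by all \<open>xs N\<close> with N large.\<close>

lemma state_complete:
  assumes xs: "\<And>m. xs m \<in> X" and st: "\<And>m n. n \<le> m \<Longrightarrow> state n (xs m) = state n (xs n)"
  shows "\<exists>x\<in>X. \<forall>n. state n x = state n (xs n)"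
proof -
  have cst: "c n (xs m) = c n (xs n)" if "n \<le> m" for m n
    using state_code[OF xs xs st[OF that]] .
  obtain x where x: "x \<in> X" and cx: "\<And>n. c n x = c n (xs n)"
    using code_complete[of xs, OF xs cst] by auto
  have "state n x = state n (xs n)" for n
  proof -
    \<comment> \<open>The upper end is included in order to control the return to
      \<open>A n\<close>.\<close>
    let ?I = "{- int (bwd n (xs n))..int (fwd n (xs n))}"
    have "\<exists>m. \<forall>z\<in>X. c m z = c m x \<longrightarrow> c n (act k z) = c n (act k x)" for k
      using code_act[OF x] by blast
    then obtain m where m: "\<And>k z. \<lbrakk>z \<in> X; c (m k) z = c (m k) x\<rbrakk> \<Longrightarrow> c n (act k z) = c n (act k x)"
      by metis
    define N where "N = Max (insert n (m ` ?I))"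
    have N: "n \<le> N" "m k \<le> N" if "k \<in> ?I" for k
    proof -
      have fin: "finite (insert n (m ` ?I))" by simp
      show "n \<le> N" "m k \<le> N" unfolding N_def using Max_ge[OF fin] that by blast+
    qed
    have "n \<le> N" using N(1)[of 0] by simp
    note D = state_eqD[OF xs xs st[OF this]]
    have eq: "c n (act k (xs N)) = c n (act k x)" if "k \<in> ?I" for k
      by (rule m) (use xs cst[OF N(2)[OF that]] cx in auto)
    have "state n x = state n (xs N)"
    proof (rule state_eqI[OF xs x])
      show "c n (act k x) = c n (act k (xs N))"
        if "- int (bwd n (xs N)) \<le> k" "k < int (fwd n (xs N))" for k
        using eq[of k] that D(1,2) by auto
      have "c n (act (int (fwd n (xs n))) (xs N)) = c n (act (int (fwd n (xs n))) x)"
        by (rule eq) auto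
      then show "act (int (fwd n (xs N))) x \<in> A n"
        using code_A act_in x xs act_fwd[OF xs] D(2) by metis
    qed
    with st[OF \<open>n \<le> N\<close>] show ?thesis by simp
  qed
  with x show ?thesis by blast
qed

lemma state_0: "\<lbrakk>x \<in> X; y \<in> X\<rbrakk> \<Longrightarrow> state 0 x = state 0 y"
  by (rule state_eqI(1)) (auto simp: A_0 act_in intro: code_0)

section \<open>The diagram of a marked coding\<close>

text \<open>The level is part of the number, which keeps different levels disjoint.\<close>

definition vertex :: "nat \<Rightarrow> 'a \<Rightarrow> nat" where
  "vertex n x = to_nat (n, block n x)"

text \<open>The edge from level \<open>n\<close> to level \<open>Suc n\<close> records the tower over \<open>A (Suc n)\<close> and the floor
  at which the tower over \<open>A n\<close> containing \<open>x\<close> starts.\<close>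

definition edge :: "nat \<Rightarrow> 'a \<Rightarrow> nat" where
  "edge n x = to_nat (Suc n, block (Suc n) x, bwd (Suc n) x - bwd n x)"

definition edge_range :: "nat \<Rightarrow> nat" where
  "edge_range e = (case from_nat e of (n :: nat, l :: nat list, _ :: nat) \<Rightarrow> to_nat (n, l))"

definition edge_pos :: "nat \<Rightarrow> nat" where
  "edge_pos e = (case from_nat e of (_ :: nat, _ :: nat list, j) \<Rightarrow> j)"

text \<open>The number of an edge does not display its source, so a point realizing the edge is
  chosen; independence of the choice is \<open>vertex_eq_of_edge_eq\<close>.\<close>

definition edge_source :: "nat \<Rightarrow> nat" where
  "edge_source e = (let (n, x) = SOME (n, x). x \<in> X \<and> edge n x = e in vertex n x)"

text \<open>\<open>edge m\<close> joins level m to level \<open>Suc m\<close>, hence the shift; the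
  value of \<open>edge_level\<close> at 0 is a dummy.\<close>

definition diag :: "(nat, nat) ordered_diagram" where
  "diag = \<lparr> vertex_level = (\<lambda>n. vertex n ` X),
     edge_level = (\<lambda>n. case n of 0 \<Rightarrow> {} | Suc m \<Rightarrow> edge m ` X),
     src = edge_source, rng = edge_range,
     edge_order = {(e, e'). e \<in> (\<Union>n. edge n ` X) \<and> e' \<in> (\<Union>n. edge n ` X) \<and>
        edge_range e = edge_range e' \<and> edge_pos e \<le> edge_pos e'} \<rparr>"

lemma vertex_eq_iff: "vertex m x = vertex n y \<longleftrightarrow> m = n \<and> block m x = block n y"
  by (simp add: vertex_def)

lemma edge_eq_iff:
  "edge m x = edge n y \<longleftrightarrow>
     m = n \<and> block (Suc m) x = block (Suc n) y \<and> bwd (Suc m) x - bwd m x = bwd (Suc n) y - bwd n y"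
  by (auto simp: edge_def)

lemma edge_range_edge: "edge_range (edge n x) = vertex (Suc n) x"
  by (simp add: edge_range_def edge_def vertex_def)

lemma edge_pos_edge: "edge_pos (edge n x) = bwd (Suc n) x - bwd n x"
  by (simp add: edge_pos_def edge_def)

lemma edge_eqI:
  "\<lbrakk>edge_range (edge m x) = edge_range (edge n y); edge_pos (edge m x) = edge_pos (edge n y)\<rbrakk>
     \<Longrightarrow> edge m x = edge n y"
  by (auto simp: edge_range_edge edge_pos_edge vertex_eq_iff edge_eq_iff)

text \<open>Moving by k inside the lower tower changes both floor numbers by k and preserves their
  difference.\<close>

lemma edge_act:
  assumes x: "x \<in> X" and k: "- int (bwd n x) \<le> k" "k < int (fwd n x)"
  shows "edge n (act k x) = edge n x"
proof -
  have k': "- int (bwd (Suc n) x) \<le> k" "k < int (fwd (Suc n) x)"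
    using k bwd_mono[OF x, of n "Suc n"] fwd_mono[OF x, of n "Suc n"] by auto
  show ?thesis
    using block_act[OF x k'] bwd_fwd_act(1)[OF x k'] bwd_fwd_act(1)[OF x k] by (simp add: edge_eq_iff)
qed

lemma vertex_act:
  assumes "x \<in> X" "- int (bwd n x) \<le> k" "k < int (fwd n x)"
  shows "vertex n (act k x) = vertex n x"
  using block_act[OF assms] by (simp add: vertex_eq_iff)

text \<open>Times are relative to x. Each element is a moment at which a tower over
  \<open>A n\<close> starts inside the tower over \<open>A (Suc n)\<close> through x; these moments
  parametrize the edges into the vertex of x.\<close>

definition visits :: "nat \<Rightarrow> 'a \<Rightarrow> int set" where
  "visits n x = {k. - int (bwd (Suc n) x) \<le> k \<and> k < int (fwd (Suc n) x) \<and> act k x \<in> A n}"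

lemma visitsD:
  assumes "x \<in> X" "k \<in> visits n x"
  shows "block (Suc n) (act k x) = block (Suc n) x"
    and "int (edge_pos (edge n (act k x))) = int (bwd (Suc n) x) + k"
  using assms block_act[of x "Suc n" k] bwd_fwd_act(1)[of x "Suc n" k]
  by (auto simp: visits_def edge_pos_edge bwd_eq_0)

lemma visits_cases:
  assumes "x \<in> X" "k \<in> visits n x"
  shows "k \<le> - int (bwd n x) \<or> k \<ge> int (fwd n x)"
  using assms no_visit_between[of x n k] by (force simp: visits_def)

lemma bwd_visits: "x \<in> X \<Longrightarrow> - int (bwd n x) \<in> visits n x"
  using act_bwd[of x n] bwd_mono[of x n "Suc n"] fwd_ge_1[of x "Suc n"] by (auto simp: visits_def)

lemma fwd_visits: "\<lbrakk>x \<in> X; fwd n x < fwd (Suc n) x\<rbrakk> \<Longrightarrow> int (fwd n x) \<in> visits n x"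
  using act_fwd[of x n] by (auto simp: visits_def)

text \<open>Descend from z to the bottom of its lower tower and take the point of the orbit of x on
  the same floor of the common upper tower. Both have the same state at level \<open>Suc n\<close>,
  hence at level n. Thus all edges into a vertex are seen on one orbit segment.\<close>

lemma edge_visit:
  assumes x: "x \<in> X" and z: "z \<in> X" and bl: "block (Suc n) z = block (Suc n) x"
  obtains k where "k \<in> visits n x" "edge n z = edge n (act k x)" "vertex n z = vertex n (act k x)"
proof -
  have kz: "- int (bwd n z) \<le> - int (bwd n z)" "- int (bwd n z) < int (fwd n z)"
    using fwd_ge_1[OF z, of n] by auto
  define z' where "z' = act (- int (bwd n z)) z"
  have z': "z' \<in> X" "z' \<in> A n" "edge n z' = edge n z" "vertex n z' = vertex n z"
    unfolding z'_def using act_in[OF z] act_bwd[OF z] edge_act[OF z kz] vertex_act[OF z kz] by auto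
  have bl': "block (Suc n) z' = block (Suc n) x"
    using z'(3) bl by (simp add: edge_eq_iff)
  define k where "k = int (bwd (Suc n) z') - int (bwd (Suc n) x)"
  have "length (block (Suc n) z') = length (block (Suc n) x)" using bl' by simp
  then have k: "- int (bwd (Suc n) x) \<le> k" "k < int (fwd (Suc n) x)"
    unfolding k_def length_block using fwd_ge_1[OF z'(1), of "Suc n"] by linarith+
  have w: "act k x \<in> X" using act_in[OF x] .
  have st: "state (Suc n) z' = state (Suc n) (act k x)"
    using block_act[OF x k] bwd_fwd_act(1)[OF x k] bl' by (simp add: state_def k_def)
  have "c n z' = c n (act k x)"
    using code_Suc[OF z'(1) w state_code[OF w z'(1) st]] .
  then have wA: "act k x \<in> A n"
    using code_A[OF z'(1) w] z'(2) by blast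
  have "state n z' = state n (act k x)"
    using state_mono[OF _ w z'(1) st, of n] by simp
  then have "vertex n z' = vertex n (act k x)"
    by (simp add: vertex_eq_iff state_def)
  moreover have "edge n z' = edge n (act k x)"
    using st bwd_eq_0[OF wA] bwd_eq_0[OF z'(2)] by (simp add: edge_eq_iff state_def)
  ultimately show thesis
    using that[of k] k wA z' by (simp add: visits_def)
qed

text \<open>The position of the edge forces the visit found by \<open>edge_visit\<close> to be the
  start of the lower tower through x.\<close>

lemma vertex_eq_of_edge_eq:
  assumes x: "x \<in> X" and z: "z \<in> X" and e: "edge n z = edge n x"
  shows "vertex n z = vertex n x"
proof -
  obtain k where k: "k \<in> visits n x" "edge n z = edge n (act k x)" "vertex n z = vertex n (act k x)"
    by (rule edge_visit[OF x z, of n]) (use e in \<open>simp add: edge_eq_iff\<close>)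
  have "int (edge_pos (edge n x)) = int (bwd (Suc n) x) - int (bwd n x)"
    using bwd_mono[OF x, of n "Suc n"] by (simp add: edge_pos_edge)
  with visitsD(2)[OF x k(1)] k(2) e have "k = - int (bwd n x)" by simp
  with k(3) show ?thesis
    using vertex_act[OF x, of n k] fwd_ge_1[OF x, of n] by simp
qed

lemma edge_source_edge: assumes "x \<in> X" shows "edge_source (edge n x) = vertex n x"
proof -
  define P where "P = (\<lambda>(m, z). z \<in> X \<and> edge m z = edge n x)"
  obtain m z where mz: "(SOME p. P p) = (m, z)" by fastforce
  have "P (n, x)" using assms by (simp add: P_def)
  then have "P (m, z)" using someI[of P] mz by metis
  then have "z \<in> X" "edge n z = edge n x" "m = n" by (auto simp: P_def edge_eq_iff)
  with vertex_eq_of_edge_eq[OF assms] mz show ?thesis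
    by (simp add: edge_source_def P_def)
qed

lemma diag_simps [simp]:
  "vertex_level diag n = vertex n ` X"
  "edge_level diag (Suc n) = edge n ` X"
  "x \<in> X \<Longrightarrow> src diag (edge n x) = vertex n x"
  "rng diag (edge n x) = vertex (Suc n) x"
  by (simp_all add: diag_def edge_source_edge edge_range_edge)

lemma edges_diag: "edges diag = (\<Union>n. edge n ` X)"
proof -
  have "{1..} = range Suc" by (auto simp: image_iff) (metis Suc_le_D)
  then show ?thesis by (simp add: edges_def diag_def)
qed

lemma edge_in_edges [simp]: "x \<in> X \<Longrightarrow> edge n x \<in> edges diag"
  by (auto simp: edges_diag)

lemma edge_order_diag:
  "(e, e') \<in> edge_order diag \<longleftrightarrow>
     e \<in> edges diag \<and> e' \<in> edges diag \<and> rng diag e = rng diag e' \<and> edge_pos e \<le> edge_pos e'"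
  by (simp add: edges_diag) (simp add: diag_def)

lemma edges_into_diag:
  assumes "x \<in> X"
  shows "edges_into diag (vertex (Suc n) x) = (\<lambda>k. edge n (act k x)) ` visits n x"
    (is "?L = ?R")
proof
  show "?L \<subseteq> ?R"
  proof
    fix e assume "e \<in> ?L"
    then obtain m z where z: "z \<in> X" "e = edge m z" "vertex (Suc m) z = vertex (Suc n) x"
      by (auto simp: edges_into_def edges_diag)
    then have "m = n" "block (Suc n) z = block (Suc n) x" by (auto simp: vertex_eq_iff)
    with edge_visit[OF assms z(1)] z(2) show "e \<in> ?R" by (metis image_eqI)
  qed
  show "?R \<subseteq> ?L"
    using visitsD(1)[OF assms] act_in[OF assms] by (auto simp: edges_into_def vertex_eq_iff)
qed

lemma finite_visits: "finite (visits n x)"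
proof (rule finite_subset)
  show "visits n x \<subseteq> {- int (bwd (Suc n) x)..int (fwd (Suc n) x)}" by (auto simp: visits_def)
qed simp

text \<open>The edge seen at visit k has position \<open>bwd (Suc n) x + k\<close>, so the edge
  order is the order in time.\<close>

lemma edge_order_visits:
  assumes x: "x \<in> X" and k: "k \<in> visits n x" and l: "l \<in> visits n x"
  shows "(edge n (act k x), edge n (act l x)) \<in> edge_order diag \<longleftrightarrow> k \<le> l"
    and "edge n (act k x) = edge n (act l x) \<longleftrightarrow> k = l"
proof -
  note pos = visitsD(2)[OF x k] visitsD(2)[OF x l]
  have "rng diag (edge n (act k x)) = rng diag (edge n (act l x))"
    using visitsD(1)[OF x k] visitsD(1)[OF x l] by (simp add: vertex_eq_iff)
  then have "(edge n (act k x), edge n (act l x)) \<in> edge_order diag \<longleftrightarrow>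
      edge_pos (edge n (act k x)) \<le> edge_pos (edge n (act l x))"
    by (simp add: edge_order_diag act_in[OF x])
  also have "\<dots> \<longleftrightarrow> k \<le> l" using pos by linarith
  finally show "(edge n (act k x), edge n (act l x)) \<in> edge_order diag \<longleftrightarrow> k \<le> l" .
  have "k = l" if "edge n (act k x) = edge n (act l x)"
    using pos unfolding that by linarith
  then show "edge n (act k x) = edge n (act l x) \<longleftrightarrow> k = l" by blast
qed

lemma edge_bwd: "x \<in> X \<Longrightarrow> edge n (act (- int (bwd n x)) x) = edge n x"
  by (rule edge_act) (use fwd_ge_1[of x n] in auto)

lemma edges_into_rng_edge:
  assumes "x \<in> X"
  shows "edges_into diag (rng diag (edge n (act (- int (bwd n x)) x))) =
    (\<lambda>k. edge n (act k x)) ` visits n x"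
  using edges_into_diag[OF assms] by (simp add: edge_bwd[OF assms])

text \<open>The first possible visit after the start of the lower tower through x is at time
  \<open>fwd n x\<close>; it falls outside the upper tower exactly when both towers end
  together.\<close>

lemma maximal_edge_iff:
  assumes x: "x \<in> X"
  shows "maximal_edge diag (edge n x) \<longleftrightarrow> fwd n x = fwd (Suc n) x"
proof -
  note b = bwd_visits[OF x, of n]
  have "maximal_edge diag (edge n x) \<longleftrightarrow>
      maximal_edge diag (edge n (act (- int (bwd n x)) x))"
    by (simp add: edge_bwd[OF x])
  also have "\<dots> \<longleftrightarrow> (\<forall>k\<in>visits n x. - int (bwd n x) \<le> k \<longrightarrow> k = - int (bwd n x))"
    unfolding maximal_edge_def edges_into_rng_edge[OF x] ball_simps
    using edge_order_visits(1)[OF x b] edge_order_visits(2)[OF x _ b] by (intro ball_cong) auto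
  also have "\<dots> \<longleftrightarrow> fwd n x = fwd (Suc n) x"
  proof
    assume R: "\<forall>k\<in>visits n x. - int (bwd n x) \<le> k \<longrightarrow> k = - int (bwd n x)"
    show "fwd n x = fwd (Suc n) x"
    proof (rule ccontr)
      assume "fwd n x \<noteq> fwd (Suc n) x"
      then have "fwd n x < fwd (Suc n) x" using fwd_mono[OF x, of n "Suc n"] by simp
      from fwd_visits[OF x this] R fwd_ge_1[OF x, of n] show False by force
    qed
  next
    assume "fwd n x = fwd (Suc n) x"
    then show "\<forall>k\<in>visits n x. - int (bwd n x) \<le> k \<longrightarrow> k = - int (bwd n x)"
      using visits_cases[OF x] by (force simp: visits_def)
  qed
  finally show ?thesis .
qed

lemma minimal_edge_iff:
  assumes x: "x \<in> X"
  shows "minimal_edge diag (edge n x) \<longleftrightarrow> bwd n x = bwd (Suc n) x"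
proof -
  note b = bwd_visits[OF x, of n]
  have "minimal_edge diag (edge n x) \<longleftrightarrow>
      minimal_edge diag (edge n (act (- int (bwd n x)) x))"
    by (simp add: edge_bwd[OF x])
  also have "\<dots> \<longleftrightarrow> (\<forall>k\<in>visits n x. k \<le> - int (bwd n x) \<longrightarrow> k = - int (bwd n x))"
    unfolding minimal_edge_def edges_into_rng_edge[OF x] ball_simps
    using edge_order_visits[OF x _ b] by (intro ball_cong) auto
  also have "\<dots> \<longleftrightarrow> bwd n x = bwd (Suc n) x"
  proof
    \<comment> \<open>The bottom of the upper tower is itself a visit, since
      \<open>A (Suc n)\<close> is contained in \<open>A n\<close>.\<close>
    have "- int (bwd (Suc n) x) \<in> visits n x"
      using act_bwd[OF x, of "Suc n"] A_antimono[of n "Suc n"] fwd_ge_1[OF x, of "Suc n"]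
      by (auto simp: visits_def)
    moreover assume "\<forall>k\<in>visits n x. k \<le> - int (bwd n x) \<longrightarrow> k = - int (bwd n x)"
    ultimately show "bwd n x = bwd (Suc n) x"
      using bwd_mono[OF x, of n "Suc n"] by force
  next
    assume "bwd n x = bwd (Suc n) x"
    then show "\<forall>k\<in>visits n x. k \<le> - int (bwd n x) \<longrightarrow> k = - int (bwd n x)"
      by (force simp: visits_def)
  qed
  finally show ?thesis .
qed

text \<open>The lower tower stacked directly above the current one starts at time
  \<open>fwd n x\<close>, which by \<open>visits_cases\<close> is the earliest later visit.\<close>

lemma edge_successor_edge:
  assumes x: "x \<in> X" and lt: "fwd n x < fwd (Suc n) x"
  shows "edge_successor diag (edge n x) = edge n (act (int (fwd n x)) x)"
proof -
  let ?b = "- int (bwd n x)" and ?f = "int (fwd n x)"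
  note b = bwd_visits[OF x, of n] and f = fwd_visits[OF x lt]
  have e: "edge n x = edge n (act ?b x)" by (simp add: edge_bwd[OF x])
  have bf: "?b < ?f" using fwd_ge_1[OF x, of n] by simp
  note ord = edge_order_visits[OF x]
  show ?thesis
    unfolding e unfolding edge_successor_def edges_into_rng_edge[OF x]
  proof (rule the_equality, goal_cases)
    case 1
    have "?f \<le> k" if "k \<in> visits n x" "?b \<le> k" "k \<noteq> ?b" for k
      using visits_cases[OF x that(1)] that by linarith
    then show ?case using ord b f bf by auto
  next
    case (2 g)
    then obtain k where k: "k \<in> visits n x" "g = edge n (act k x)" by auto
    with 2 have *: "?b \<le> k" "k \<noteq> ?b" using ord b by auto
    have "k \<le> ?f" using 2 k ord b f bf by auto
    with visits_cases[OF x k(1)] * have "k = ?f" by linarith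
    with k show ?case by simp
  qed
qed

section \<open>Itineraries and the Vershik map\<close>

definition itinerary :: "'a \<Rightarrow> nat \<Rightarrow> nat" where
  "itinerary x = (\<lambda>n. edge n x)"

text \<open>The positions of the first n edges add up to the floor \<open>bwd n x\<close>, and the
  last of these edges names the tower. At level 0 there is only one state.\<close>

lemma state_eq_iff_edges:
  assumes x: "x \<in> X" and y: "y \<in> X"
  shows "state n x = state n y \<longleftrightarrow> (\<forall>i<n. edge i x = edge i y)"
proof
  assume st: "state n x = state n y"
  show "\<forall>i<n. edge i x = edge i y"
  proof (intro allI impI)
    fix i assume "i < n"
    then have "state i x = state i y" "state (Suc i) x = state (Suc i) y"
      using state_mono[OF _ y x st] by simp_all
    then show "edge i x = edge i y" by (simp add: edge_eq_iff state_def)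
  qed
next
  show "state n x = state n y" if "\<forall>i<n. edge i x = edge i y"
    using that
  proof (induction n)
    case 0
    show ?case by (rule state_0[OF x y])
  next
    case (Suc n)
    then have "bwd n x = bwd n y" "edge n x = edge n y" by (simp_all add: state_def)
    then show ?case
      using bwd_mono[OF x, of n "Suc n"] bwd_mono[OF y, of n "Suc n"]
      by (auto simp: edge_eq_iff state_def)
  qed
qed

lemma itinerary_in_path_space: "x \<in> X \<Longrightarrow> itinerary x \<in> path_space diag"
  by (simp add: path_space_def itinerary_def)

lemma itinerary_inj: "inj_on itinerary X"
proof (rule inj_onI)
  fix x y assume x: "x \<in> X" and y: "y \<in> X" and eq: "itinerary x = itinerary y"
  then have "state n x = state n y" for n
    by (simp add: state_eq_iff_edges itinerary_def fun_eq_iff)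
  then show "x = y" using code_inj[OF x y] state_code[OF y x] by blast
qed

text \<open>Gluing: since source and range match, a point z realizing the next edge lies in the same
  tower at level n as the point x realizing the first n edges. Sliding z to the floor of x gives it
  these edges and does not alter \<open>edge n\<close>.\<close>

lemma path_prefix_realized:
  assumes y: "y \<in> path_space diag"
  shows "\<exists>x\<in>X. \<forall>i<n. edge i x = y i"
proof (induction n)
  case 0
  from y have "y 0 \<in> edge_level diag (Suc 0)" unfolding path_space_def by blast
  then show ?case by auto
next
  case (Suc n)
  then obtain x where x: "x \<in> X" "\<And>i. i < n \<Longrightarrow> edge i x = y i" by auto
  have "y n \<in> edge_level diag (Suc n)" using y unfolding path_space_def by blast
  then obtain z where z: "z \<in> X" "y n = edge n z" by auto
  have bl: "block n z = block n x"
  proof (cases n)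
    case 0
    with state_0[OF z(1) x(1)] show ?thesis by (simp add: state_def)
  next
    case (Suc m)
    have "src diag (y (Suc m)) = rng diag (y m)" using y by (simp add: path_space_def)
    then have "vertex n z = vertex n x" using z Suc x(2)[of m, symmetric] by simp
    then show ?thesis by (simp add: vertex_eq_iff)
  qed
  define k where "k = int (bwd n x) - int (bwd n z)"
  have "length (block n z) = length (block n x)" using bl by simp
  then have k: "- int (bwd n z) \<le> k" "k < int (fwd n z)"
    unfolding k_def length_block using fwd_ge_1[OF x(1), of n] by linarith+
  have "state n (act k z) = state n x"
    using block_act[OF z(1) k] bwd_fwd_act(1)[OF z(1) k] bl by (simp add: state_def k_def)
  then have "\<forall>i<n. edge i (act k z) = y i"
    using state_eq_iff_edges[OF act_in[OF z(1)] x(1)] x(2) by simp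
  moreover have "edge n (act k z) = y n" using edge_act[OF z(1) k] z(2) by simp
  ultimately show ?case using act_in[OF z(1), of k] by (auto simp: less_Suc_eq)
qed

text \<open>The points realizing longer and longer prefixes of a path have compatible states, so
  \<open>state_complete\<close> supplies one point realizing the whole path.\<close>

lemma itinerary_image: "itinerary ` X = path_space diag"
proof
  show "path_space diag \<subseteq> itinerary ` X"
  proof
    fix y assume y: "y \<in> path_space diag"
    have "\<forall>n. \<exists>x\<in>X. \<forall>i<n. edge i x = y i"
      using path_prefix_realized[OF y] by blast
    then obtain xs where xs: "\<And>n. xs n \<in> X" "\<And>n i. i < n \<Longrightarrow> edge i (xs n) = y i" by metis
    have "state n (xs m) = state n (xs n)" if "n \<le> m" for m n
      using that xs by (simp add: state_eq_iff_edges)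
    from state_complete[of xs, OF xs(1) this]
    obtain x where x: "x \<in> X" "\<And>n. state n x = state n (xs n)" by auto
    have "edge n x = y n" for n
    proof -
      have "edge n x = edge n (xs (Suc n))"
        using x(2)[of "Suc n"] state_eq_iff_edges[OF x(1) xs(1)] by blast
      with xs(2) show ?thesis by simp
    qed
    then have "y = itinerary x" by (simp add: itinerary_def fun_eq_iff)
    with x(1) show "y \<in> itinerary ` X" by blast
  qed
qed (auto intro: itinerary_in_path_space)

section \<open>The axioms of an ordered Borel-Bratteli diagram for \<open>diag\<close>\<close>

lemma vertex_0_eq: "\<lbrakk>x \<in> X; y \<in> X\<rbrakk> \<Longrightarrow> vertex 0 x = vertex 0 y"
  using state_0[of x y] by (simp add: state_def vertex_eq_iff)

lemma vertices_diag: "vertices diag = (\<Union>n. vertex n ` X)"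
  by (simp add: vertices_def)

lemma vertex_Suc_notin: "vertex (Suc n) x \<notin> vertex 0 ` X"
  by (auto simp: vertex_eq_iff)

lemma borel_bratteli_diagram_diag:
  assumes "X \<noteq> {}"
  shows "borel_bratteli_diagram diag"
  unfolding borel_bratteli_diagram_def
proof (intro conjI allI impI ballI)
  show "disjoint_family (vertex_level diag)"
    by (auto simp: disjoint_family_on_def vertex_eq_iff)
  show "disjoint_family_on (edge_level diag) {1..}"
    unfolding disjoint_family_on_def
  proof (intro ballI impI)
    fix m n :: nat assume "m \<in> {1..}" "n \<in> {1..}" "m \<noteq> n"
    then obtain m' n' where "m = Suc m'" "n = Suc n'" "m' \<noteq> n'"
      by (metis atLeast_iff not0_implies_Suc not_one_le_zero)
    then show "edge_level diag m \<inter> edge_level diag n = {}" by (auto simp: edge_eq_iff)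
  qed
  show "\<exists>v0. vertex_level diag 0 = {v0}"
  proof -
    obtain x0 where "x0 \<in> X" using assms by auto
    then have "vertex_level diag 0 = {vertex 0 x0}" by (auto intro: vertex_0_eq)
    then show ?thesis by blast
  qed
  show "countable (vertex_level diag i)" "countable (edge_level diag i)" for i
    by (rule countableI_type)+
  show "rng diag ` edge_level diag i \<subseteq> vertex_level diag i" if "1 \<le> i" for i
    using that by (cases i) auto
  show "src diag ` edge_level diag i \<subseteq> vertex_level diag (i - 1)" if "1 \<le> i" for i
    using that by (cases i) auto
  show "edges_from diag v \<noteq> {}" if v: "v \<in> vertices diag" for v
  proof -
    obtain n x where "x \<in> X" "v = vertex n x" using v unfolding vertices_diag by blast
    then have "edge n x \<in> edges_from diag v" by (simp add: edges_from_def)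
    then show ?thesis by blast
  qed
  fix v assume "v \<in> vertices diag - vertex_level diag 0"
  then obtain n x where nx: "x \<in> X" "v = vertex n x" "n \<noteq> 0" by (force simp: vertices_diag)
  then obtain m where m: "v = vertex (Suc m) x" by (metis not0_implies_Suc)
  show "edges_into diag v \<noteq> {}"
    using bwd_visits[OF nx(1), of m] by (auto simp: m edges_into_diag[OF nx(1)])
  show "finite (edges_into diag v)"
    by (simp add: m edges_into_diag[OF nx(1)] finite_visits)
qed

text \<open>Maximality from level n on freezes the return times, so the common return point would
  lie in every \<open>A i\<close>.\<close>

lemma no_cofinal_maximal:
  assumes y: "y \<in> path_space diag"
  shows "\<exists>i\<ge>n. \<not> maximal_edge diag (y i)"
proof (rule ccontr)
  assume "\<not> ?thesis"
  then have max: "maximal_edge diag (y i)" if "n \<le> i" for i using that by blast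
  obtain x where x: "x \<in> X" "y = itinerary x" using y itinerary_image by auto
  have "fwd i x = fwd n x" if "n \<le> i" for i
    using that
  proof (induction i rule: dec_induct)
    case (step m)
    then show ?case using max[of m] maximal_edge_iff[OF x(1)] x(2) by (simp add: itinerary_def)
  qed simp
  then have "act (int (fwd n x)) x \<in> A i" if "n \<le> i" for i
    using act_fwd[OF x(1), of i] that by metis
  then have "act (int (fwd n x)) x \<in> A i" for i
    using A_antimono[of i "max i n"] by (meson max.cobounded1 max.cobounded2 subsetD)
  with A_vanish show False by blast
qed

text \<open>Minimality from level n on freezes the bottoms of the towers instead.\<close>

lemma no_cofinal_minimal:
  assumes y: "y \<in> path_space diag"
  shows "\<exists>i\<ge>n. \<not> minimal_edge diag (y i)"
proof (rule ccontr)
  assume "\<not> ?thesis"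
  then have min: "minimal_edge diag (y i)" if "n \<le> i" for i using that by blast
  obtain x where x: "x \<in> X" "y = itinerary x" using y itinerary_image by auto
  have "bwd i x = bwd n x" if "n \<le> i" for i
    using that
  proof (induction i rule: dec_induct)
    case (step m)
    then show ?case using min[of m] minimal_edge_iff[OF x(1)] x(2) by (simp add: itinerary_def)
  qed simp
  then have "act (- int (bwd n x)) x \<in> A i" if "n \<le> i" for i
    using act_bwd[OF x(1), of i] that by metis
  then have "act (- int (bwd n x)) x \<in> A i" for i
    using A_antimono[of i "max i n"] by (meson max.cobounded1 max.cobounded2 subsetD)
  with A_vanish show False by blast
qed

lemma edge_order_antisym:
  assumes "e \<in> edges diag" "e' \<in> edges diag" "rng diag e = rng diag e'" "edge_pos e = edge_pos e'"
  shows "e = e'"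
proof -
  obtain m x n y where e: "e = edge m x" "e' = edge n y"
    using assms(1,2) unfolding edges_diag by blast
  have "edge m x = edge n y"
    by (rule edge_eqI) (use assms(3,4) in \<open>simp_all add: e edge_range_edge\<close>)
  then show ?thesis by (simp only: e)
qed

lemma ordered_borel_bratteli_diagram_diag:
  assumes "X \<noteq> {}"
  shows "ordered_borel_bratteli_diagram diag"
  unfolding ordered_borel_bratteli_diagram_def
proof (intro conjI)
  show "borel_bratteli_diagram diag" by (rule borel_bratteli_diagram_diag[OF assms])
  show "partial_order_on (edges diag) (edge_order diag)"
    unfolding partial_order_on_def preorder_on_def refl_on_def
  proof (intro conjI)
    show "edge_order diag \<subseteq> edges diag \<times> edges diag"
      by (rule subrelI) (metis SigmaI edge_order_diag)
    show "trans (edge_order diag)"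
    proof (rule transI)
      fix e e' e'' assume "(e, e') \<in> edge_order diag" "(e', e'') \<in> edge_order diag"
      then show "(e, e'') \<in> edge_order diag" unfolding edge_order_diag
        by (elim conjE, intro conjI) (assumption | erule (1) trans le_trans)+
    qed
    show "antisym (edge_order diag)"
    proof (rule antisymI)
      fix e e' assume "(e, e') \<in> edge_order diag" "(e', e) \<in> edge_order diag"
      then show "e = e'"
        using edge_order_antisym[of e e'] le_antisym[of "edge_pos e" "edge_pos e'"]
        unfolding edge_order_diag by blast
    qed
  qed (use edge_order_diag in blast)
  show "\<forall>e\<in>edges diag. \<forall>e'\<in>edges diag.
      ((e, e') \<in> edge_order diag \<or> (e', e) \<in> edge_order diag) = (rng diag e = rng diag e')"
  proof (intro ballI)
    fix e e' assume "e \<in> edges diag" "e' \<in> edges diag"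
    with nat_le_linear[of "edge_pos e" "edge_pos e'"]
    show "((e, e') \<in> edge_order diag \<or> (e', e) \<in> edge_order diag) = (rng diag e = rng diag e')"
      unfolding edge_order_diag by metis
  qed
qed (use no_cofinal_maximal no_cofinal_minimal in blast)+

text \<open>An edge is minimal if lower and upper tower start together, that is, if its position is
  0. The upper tower and the position determine the edge, so the path is forced downwards from its
  end. As x is at the bottom of its towers up to level k, its edges below k have position 0
  too.\<close>

lemma minimal_path_unique:
  assumes "path_from_root diag p (vertex k x)" "\<forall>e\<in>set p. minimal_edge diag e"
    and "x \<in> X" "x \<in> A k"
  shows "p = map (\<lambda>i. edge i x) [0..<k]"
  using assms
proof (induction k arbitrary: p)
  case 0
  show ?case
  proof (cases p rule: rev_cases)
    case (snoc q e)
    with 0 have "e \<in> edge_level diag (Suc (length q))" "rng diag e = vertex 0 x"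
      by (auto simp: path_from_root_def nth_append)
    then show ?thesis by (auto simp: vertex_eq_iff)
  qed simp
next
  case (Suc k)
  have x: "x \<in> X" "x \<in> A k" "x \<in> A (Suc k)" using Suc.prems A_antimono[of k "Suc k"] by auto
  show ?case
  proof (cases p rule: rev_cases)
    case Nil
    with Suc.prems vertex_Suc_notin show ?thesis by (simp add: path_from_root_def)
  next
    case (snoc q e)
    have path: "\<And>i. i < Suc (length q) \<Longrightarrow> (q @ [e]) ! i \<in> edge_level diag (Suc i)"
      "\<And>i. Suc i < Suc (length q) \<Longrightarrow> src diag ((q @ [e]) ! Suc i) = rng diag ((q @ [e]) ! i)"
      "rng diag e = vertex (Suc k) x"
      using Suc.prems(1) by (auto simp: path_from_root_def snoc)
    have "e \<in> edge_level diag (Suc (length q))" using path(1)[of "length q"] by simp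
    with path(3) obtain z where z: "z \<in> X" "e = edge (length q) z" "length q = k"
        "block (Suc k) z = block (Suc k) x"
      by (auto simp: vertex_eq_iff)
    then have "bwd k z = bwd (Suc k) z"
      using Suc.prems(2) minimal_edge_iff[OF z(1)] by (simp add: snoc)
    with z have e: "e = edge k x" by (simp add: edge_eq_iff bwd_eq_0 x)
    have "path_from_root diag q (vertex k x)"
    proof (cases q rule: rev_cases)
      case Nil
      with z x show ?thesis by (simp add: path_from_root_def)
    next
      case (snoc q' e')
      then have "rng diag e' = vertex k x"
        using path(2)[of "length q'"] e x by (simp add: nth_append)
      moreover have "q ! i \<in> edge_level diag (Suc i)" if "i < length q" for i
        using path(1)[of i] that by (simp add: nth_append)
      moreover have "src diag (q ! Suc i) = rng diag (q ! i)" if "Suc i < length q" for i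
        using path(2)[of i] that by (simp add: nth_append)
      ultimately show ?thesis by (simp add: path_from_root_def snoc)
    qed
    then have "q = map (\<lambda>i. edge i x) [0..<k]"
      using Suc.prems(2) x by (intro Suc.IH) (auto simp: snoc)
    with e show ?thesis by (simp add: snoc)
  qed
qed

lemma minimal_path_vertex:
  assumes x: "x \<in> X" "x \<in> A k"
  shows "minimal_path diag (vertex k x) = map (\<lambda>i. edge i x) [0..<k]"
  unfolding minimal_path_def
proof (rule the_equality)
  have "bwd i x = 0" if "i \<le> k" for i
    using that x(2) A_antimono[of i k] by (intro bwd_eq_0) auto
  then have "\<forall>e\<in>set (map (\<lambda>i. edge i x) [0..<k]). minimal_edge diag e"
    by (auto simp: minimal_edge_iff[OF x(1)])
  moreover have "path_from_root diag (map (\<lambda>i. edge i x) [0..<k]) (vertex k x)"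
    using x by (cases k) (auto simp: path_from_root_def nth_append less_Suc_eq)
  ultimately show "path_from_root diag (map (\<lambda>i. edge i x) [0..<k]) (vertex k x) \<and>
    (\<forall>e\<in>set (map (\<lambda>i. edge i x) [0..<k]). minimal_edge diag e)" by blast
qed (use minimal_path_unique x in blast)

text \<open>At level 0 the return time is 1, and maximality below k propagates this up to level k.
  So \<open>act 1 x\<close> is in \<open>A k\<close>: it starts the next lower tower at level k,
  which gives the successor edge, with minimal edges below. Above k the step from x to
  \<open>act 1 x\<close> stays inside one tower and changes no edge.\<close>

lemma vershik_itinerary:
  assumes x: "x \<in> X"
  shows "vershik diag (itinerary x) = itinerary (act 1 x)"
proof -
  define k where "k = (LEAST k. \<not> maximal_edge diag (itinerary x k))"
  have "\<exists>k. \<not> maximal_edge diag (itinerary x k)"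
    using no_cofinal_maximal[OF itinerary_in_path_space[OF x]] by blast
  then have "\<not> maximal_edge diag (itinerary x k)" unfolding k_def by (rule LeastI_ex)
  then have lt: "fwd k x < fwd (Suc k) x"
    using fwd_mono[OF x, of k "Suc k"] by (simp add: itinerary_def maximal_edge_iff[OF x])
  have least: "fwd i x = fwd (Suc i) x" if "i < k" for i
    using not_less_Least[OF that[unfolded k_def]] by (simp add: itinerary_def maximal_edge_iff[OF x])
  have "fwd i x = 1" if "i \<le> k" for i
    using that
  proof (induction i)
    case 0
    show ?case by (rule fwd_0[OF x])
  next
    case (Suc i)
    then show ?case using least[of i] by simp
  qed
  then have f: "fwd k x = 1" by simp
  have Tx: "act 1 x \<in> X" "act 1 x \<in> A k"
    using act_in[OF x] act_fwd[OF x, of k] f by auto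
  have succ: "edge_successor diag (itinerary x k) = edge k (act 1 x)"
    using edge_successor_edge[OF x lt] f by (simp add: itinerary_def)
  have above: "edge i (act 1 x) = edge i x" if "k < i" for i
  proof (rule edge_act[OF x])
    show "1 < int (fwd i x)" using lt f fwd_mono[OF x, of "Suc k" i] that by simp
  qed simp
  show ?thesis
    unfolding vershik_def Let_def k_def[symmetric] succ diag_simps(3)[OF Tx(1)]
      minimal_path_vertex[OF Tx]
    using above by (auto simp: itinerary_def fun_eq_iff not_less)
qed

end

section \<open>Borel structure of the path space\<close>

lemma space_borel_of: "space (borel_of S) = topspace S"
  by (simp add: borel_of_def space_measure_of_conv)

lemma sets_borel_of: "sets (borel_of S) = sigma_sets (topspace S) {U. openin S U}"
  unfolding borel_of_def using openin_subset by (intro sets_measure_of) blast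

lemma cylinder_antimono:
  "m \<le> n \<Longrightarrow> cylinder B (map y [0..<n]) \<subseteq> cylinder B (map y [0..<m])"
  by (auto simp: cylinder_def)

lemma topspace_path_topology: "topspace (path_topology B) = path_space B"
proof -
  have "cylinder B [] = path_space B" by (simp add: cylinder_def)
  then have "path_space B \<subseteq> (\<Union>p. cylinder B p)" by blast
  then show ?thesis by (auto simp: path_topology_def cylinder_def)
qed

lemma open_contains_cylinder:
  assumes "openin (path_topology B) U" "y \<in> U"
  shows "\<exists>n. cylinder B (map y [0..<n]) \<subseteq> U"
proof -
  have "generate_topology_on (range (cylinder B)) U"
    using assms(1) by (simp add: path_topology_def openin_topology_generated_by_iff)
  then show ?thesis
    using assms(2)
  proof induction
    case (Int U V)
    then obtain m n where "cylinder B (map y [0..<m]) \<subseteq> U" "cylinder B (map y [0..<n]) \<subseteq> V" by auto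
    then have "cylinder B (map y [0..<max m n]) \<subseteq> U \<inter> V"
      using cylinder_antimono[of m "max m n" B y] cylinder_antimono[of n "max m n" B y] by auto
    then show ?case by blast
  next
    case (UN K)
    then show ?case by (meson Sup_upper2 UnionE)
  next
    case (Basis s)
    then obtain p where p: "s = cylinder B p" by auto
    with Basis have "cylinder B (map y [0..<length p]) \<subseteq> s" by (auto simp: cylinder_def)
    then show ?case by blast
  qed simp
qed

text \<open>By \<open>code_generates\<close> the inverse of the itinerary map has to be tested on
  code sets only, so no theorem on injective images of Borel sets enters.\<close>

locale borel_marked_coding = marked_coding "space M" act A c
  for M :: "'a measure" and act A c +
  assumes act_measurable: "act i \<in> M \<rightarrow>\<^sub>M M"
    and code_measurable: "c n \<in> M \<rightarrow>\<^sub>M count_space UNIV"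
    and A_measurable: "A n \<in> sets M"
    and code_generates: "sets M \<subseteq> sigma_sets (space M) {{x \<in> space M. c n x = j} |n j. True}"
begin

text \<open>By \<open>state_eqI\<close> the class is cut out by finitely many conditions on
  translates of x.\<close>

lemma state_measurable:
  assumes x0: "x0 \<in> space M"
  shows "{x \<in> space M. state n x = state n x0} \<in> sets M" (is "?S \<in> _")
proof -
  let ?I = "{- int (bwd n x0)..<int (fwd n x0)}"
  have "?S = {x \<in> space M. act (int (fwd n x0)) x \<in> A n \<and>
      (\<forall>k\<in>?I. c n (act k x) = c n (act k x0))}"
  proof (intro Collect_cong conj_cong refl iffI)
    fix x assume x: "x \<in> space M" and st: "state n x = state n x0"
    show "act (int (fwd n x0)) x \<in> A n \<and> (\<forall>k\<in>?I. c n (act k x) = c n (act k x0))"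
      using state_eqD(2,4)[OF x0 x st] act_fwd[OF x, of n] by auto
  qed (use state_eqI(1)[OF x0] in auto)
  also have "\<dots> \<in> sets M"
  proof -
    have "(\<lambda>x. c n (act k x)) \<in> M \<rightarrow>\<^sub>M count_space UNIV" for k
      using measurable_compose[OF act_measurable code_measurable] .
    from measurable_sets[OF this, of "{j}" for j]
    have "{x \<in> space M. c n (act k x) = j} \<in> sets M" for k j
      by (simp add: vimage_def Int_def conj_commute)
    moreover have "{x \<in> space M. act k x \<in> A n} \<in> sets M" for k
      using measurable_sets[OF act_measurable A_measurable, of k n]
      by (simp add: vimage_def Int_def conj_commute)
    moreover have "?I \<noteq> {}" using fwd_ge_1[OF x0, of n] by simp
    ultimately show ?thesis by (intro sets.sets_Collect_conj sets.sets_Collect_finite_All') simp_all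
  qed
  finally show ?thesis .
qed

text \<open>A nonempty preimage is a single state class at level \<open>length p\<close>.\<close>

lemma itinerary_vimage_cylinder: "itinerary -` cylinder diag p \<inter> space M \<in> sets M" (is "?S \<in> _")
proof (cases "?S = {}")
  case False
  then obtain x0 where x0: "x0 \<in> space M" "itinerary x0 \<in> cylinder diag p" by auto
  have "?S = {x \<in> space M. state (length p) x = state (length p) x0}"
  proof (intro set_eqI)
    fix x
    show "x \<in> ?S \<longleftrightarrow> x \<in> {x \<in> space M. state (length p) x = state (length p) x0}"
      using x0 itinerary_in_path_space state_eq_iff_edges[of x x0]
      by (auto simp: cylinder_def itinerary_def)
  qed
  with state_measurable[OF x0(1)] show ?thesis by simp
qed simp

lemma itinerary_measurable: "itinerary \<in> M \<rightarrow>\<^sub>M borel_of (path_topology diag)"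
  unfolding borel_of_def
proof (rule measurable_measure_of)
  show "{U. openin (path_topology diag) U} \<subseteq> Pow (topspace (path_topology diag))"
    using openin_subset by blast
  show "itinerary \<in> space M \<rightarrow> topspace (path_topology diag)"
    using itinerary_in_path_space by (auto simp: topspace_path_topology)
  fix U assume U: "U \<in> {U. openin (path_topology diag) U}"
  then have sub: "U \<subseteq> path_space diag"
    using openin_subset topspace_path_topology by blast
  \<comment> \<open>There are only countably many lists p, so this is a countable union.\<close>
  have "U = (\<Union>p\<in>{p. cylinder diag p \<subseteq> U}. cylinder diag p)"
  proof
    show "U \<subseteq> (\<Union>p\<in>{p. cylinder diag p \<subseteq> U}. cylinder diag p)"
    proof
      fix y assume y: "y \<in> U"
      with U obtain n where "cylinder diag (map y [0..<n]) \<subseteq> U"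
        using open_contains_cylinder by blast
      moreover have "y \<in> cylinder diag (map y [0..<n])" using y sub by (auto simp: cylinder_def)
      ultimately show "y \<in> (\<Union>p\<in>{p. cylinder diag p \<subseteq> U}. cylinder diag p)" by blast
    qed
  qed blast
  then have "itinerary -` U \<inter> space M =
      (\<Union>p\<in>{p. cylinder diag p \<subseteq> U}. itinerary -` cylinder diag p \<inter> space M)"
    by blast
  also have "\<dots> \<in> sets M"
    by (rule sets.countable_UN') (auto intro: itinerary_vimage_cylinder countableI_type)
  finally show "itinerary -` U \<inter> space M \<in> sets M" .
qed

text \<open>The first n edges determine the state at level n and hence \<open>c n\<close>, so the
  image is a union of cylinders.\<close>

lemma itinerary_image_code_set:
  "itinerary ` {x \<in> space M. c n x = j} \<in> sets (borel_of (path_topology diag))" (is "itinerary ` ?S \<in> _")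
proof -
  let ?C = "\<lambda>x. cylinder diag (map (itinerary x) [0..<n])"
  have "itinerary ` ?S = (\<Union>x\<in>?S. ?C x)"
  proof
    show "itinerary ` ?S \<subseteq> (\<Union>x\<in>?S. ?C x)"
      using itinerary_in_path_space by (auto simp: cylinder_def)
    show "(\<Union>x\<in>?S. ?C x) \<subseteq> itinerary ` ?S"
    proof
      fix y assume "y \<in> (\<Union>x\<in>?S. ?C x)"
      then obtain x where x: "x \<in> ?S" "y \<in> path_space diag" "\<forall>i<n. y i = edge i x"
        by (auto simp: cylinder_def itinerary_def)
      then obtain z where z: "z \<in> space M" "y = itinerary z" using itinerary_image by blast
      then have "state n z = state n x" using x state_eq_iff_edges by (simp add: itinerary_def)
      then have "c n z = c n x" using state_code[of x z n] x z by simp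
      with x z show "y \<in> itinerary ` ?S" by auto
    qed
  qed
  moreover have "openin (path_topology diag) (\<Union>x\<in>?S. ?C x)"
    unfolding path_topology_def by (intro openin_Union) (auto intro: topology_generated_by_Basis)
  ultimately show ?thesis by (auto simp: sets_borel_of)
qed

lemma borel_isomorphism_itinerary: "borel_isomorphism M (borel_of (path_topology diag)) itinerary"
  unfolding borel_isomorphism_def
proof (intro conjI itinerary_measurable)
  let ?N = "borel_of (path_topology diag)" and ?g = "the_inv_into (space M) itinerary"
  have space: "space ?N = path_space diag" by (simp add: space_borel_of topspace_path_topology)
  show bij: "bij_betw itinerary (space M) (space ?N)"
    using itinerary_inj itinerary_image by (simp add: bij_betw_def space)
  let ?G = "{{x \<in> space M. c n x = j} |n j. True}"
  have g: "?g \<in> space ?N \<rightarrow> space M"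
    using bij_betw_the_inv_into[OF bij] by (auto simp: bij_betw_def)
  have "?g \<in> ?N \<rightarrow>\<^sub>M sigma (space M) ?G"
  proof (rule measurable_measure_of)
    fix S assume "S \<in> ?G"
    then obtain n j where S: "S = {x \<in> space M. c n x = j}" by auto
    have "?g -` S \<inter> space ?N = itinerary ` S"
    proof (intro set_eqI iffI)
      fix y assume "y \<in> ?g -` S \<inter> space ?N"
      then show "y \<in> itinerary ` S"
        using f_the_inv_into_f_bij_betw[OF bij] by (metis IntD1 IntD2 imageI vimageD)
    next
      fix y assume "y \<in> itinerary ` S"
      then obtain x where "x \<in> S" "x \<in> space M" "y = itinerary x" by (auto simp: S)
      then show "y \<in> ?g -` S \<inter> space ?N"
        using the_inv_into_f_f[OF itinerary_inj] bij by (auto simp: bij_betw_def)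
    qed
    with itinerary_image_code_set show "?g -` S \<inter> space ?N \<in> sets ?N" by (simp add: S)
  qed (use g in auto)
  moreover have "sets M \<subseteq> sets (sigma (space M) ?G)"
    using code_generates by (subst sets_measure_of) auto
  ultimately show "?g \<in> ?N \<rightarrow>\<^sub>M M"
    using g by (auto simp: measurable_def)
qed

lemma isomorphic_systems_diag:
  assumes "\<And>x. x \<in> space M \<Longrightarrow> T x = act 1 x"
  shows "isomorphic_systems M T (borel_of (path_topology diag)) (vershik diag)"
  unfolding isomorphic_systems_def
  using borel_isomorphism_itinerary vershik_itinerary assms by auto

end

section \<open>Vanishing markers\<close>

locale aperiodic_borel_action =
  fixes M :: "'a measure" and act :: "int \<Rightarrow> 'a \<Rightarrow> 'a"
  assumes act_0: "x \<in> space M \<Longrightarrow> act 0 x = x"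
    and act_add: "x \<in> space M \<Longrightarrow> act i (act j x) = act (i + j) x"
    and act_measurable: "act i \<in> M \<rightarrow>\<^sub>M M"
    and act_free: "\<lbrakk>x \<in> space M; act k x = x\<rbrakk> \<Longrightarrow> k = 0"
begin

lemma act_in: "x \<in> space M \<Longrightarrow> act i x \<in> space M"
  using measurable_space[OF act_measurable] .

definition recurrent_points :: "'a set \<Rightarrow> 'a set" where
  "recurrent_points B = {x \<in> space M. \<exists>\<^sub>\<infinity>k::nat. act (int k) x \<in> B}"

lemma recurrent_points_measurable:
  assumes "B \<in> sets M" shows "recurrent_points B \<in> sets M"
proof -
  have "{x \<in> space M. act k x \<in> B} \<in> sets M" for k
    using measurable_sets[OF act_measurable assms, of k] by (simp add: vimage_def Int_def conj_commute)
  then show ?thesis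
    unfolding recurrent_points_def INFM_nat_le Bex_def
    by (intro sets.sets_Collect_countable_All sets.sets_Collect_countable_Ex sets.sets_Collect_conj)
      auto
qed

text \<open>Translation by m shifts all times of visit by a constant, which does not affect their
  infinitude. This makes choices based on recurrence constant along orbits.\<close>

lemma recurrent_points_act_iff:
  assumes x: "x \<in> space M"
  shows "act m x \<in> recurrent_points B \<longleftrightarrow> x \<in> recurrent_points B"
proof -
  have *: "act m x \<in> recurrent_points B" if "x \<in> recurrent_points B" for m x
  proof -
    have x: "x \<in> space M" and inf: "\<And>N. \<exists>k\<ge>N. act (int k) x \<in> B"
      using that by (auto simp: recurrent_points_def INFM_nat_le)
    have "\<exists>k\<ge>N. act (int k) (act m x) \<in> B" for N
    proof -
      \<comment> \<open>The summand \<open>nat \<bar>m\<bar>\<close> keeps the shifted time at least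
        N.\<close>
      obtain k where k: "k \<ge> N + nat \<bar>m\<bar>" "act (int k) x \<in> B" using inf by blast
      have "int (nat (int k - m)) = int k - m" using k(1) by linarith
      then have "act (int (nat (int k - m))) (act m x) = act (int k) x"
        using k(1) act_add[OF x, of "int k - m" m] by simp
      moreover have "nat (int k - m) \<ge> N" using k(1) by linarith
      ultimately show ?thesis using k(2) by metis
    qed
    then show ?thesis by (simp add: recurrent_points_def INFM_nat_le act_in[OF x])
  qed
  show ?thesis
    using *[of x m] *[of "act m x" "- m"] act_add[OF x, of "- m" m] act_0[OF x] by auto
qed

text \<open>Of the parts of the marker set inside and outside \<open>G n\<close> keep one which the forward orbit visits
  infinitely often. The choice is constant along orbits, so two points of an orbit that are never
  discarded are not separated by any \<open>G n\<close>.\<close>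

lemma forward_markers:
  assumes G: "\<And>n. G n \<in> sets M"
    and separating: "\<And>x y. \<lbrakk>x \<in> space M; y \<in> space M; \<And>n :: nat. x \<in> G n \<longleftrightarrow> y \<in> G n\<rbrakk> \<Longrightarrow> x = y"
  obtains F where "decseq F" "\<And>n. F n \<in> sets M"
    and "\<And>n x. x \<in> space M \<Longrightarrow> \<exists>\<^sub>\<infinity>k::nat. act (int k) x \<in> F n"
    and "\<And>x k. \<lbrakk>x \<in> (\<Inter>n. F n); act k x \<in> (\<Inter>n. F n)\<rbrakk> \<Longrightarrow> k = 0"
proof -
  \<comment> \<open>On orbits visiting \<open>B \<inter> G n\<close> infinitely often this keeps
    that part of B, on all others the part outside \<open>G n\<close>.\<close>
  define step where "step n B = B \<inter> {x. x \<in> recurrent_points (B \<inter> G n) \<longleftrightarrow> x \<in> G n}" for n B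
  define F where "F = rec_nat (space M) step"
  have F_simps: "F 0 = space M" "F (Suc n) = step n (F n)" for n by (simp_all add: F_def)
  have F_sets: "F n \<in> sets M" for n
  proof (induction n)
    case (Suc n)
    let ?R = "recurrent_points (F n \<inter> G n)"
    have "?R \<in> sets M" using Suc G by (intro recurrent_points_measurable) auto
    moreover have "F (Suc n) = F n \<inter> ((?R \<inter> G n) \<union> (space M - (?R \<union> G n)))"
      using sets.sets_into_space[OF Suc] by (auto simp: F_simps step_def)
    ultimately show ?case using Suc G by auto
  qed (simp add: F_simps)
  have dec: "decseq F" by (rule decseq_SucI) (auto simp: F_simps step_def)
  have rec: "x \<in> recurrent_points (F n)" if x: "x \<in> space M" for n x
  proof (induction n)
    case 0
    show ?case using act_in[OF x] x by (simp add: recurrent_points_def F_simps)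
  next
    case (Suc n)
    let ?R = "recurrent_points (F n \<inter> G n)"
    have inf: "\<exists>\<^sub>\<infinity>k::nat. act (int k) x \<in> F n" using Suc by (simp add: recurrent_points_def)
    have R: "act k x \<in> ?R \<longleftrightarrow> x \<in> ?R" for k by (rule recurrent_points_act_iff[OF x])
    have "\<exists>\<^sub>\<infinity>k::nat. act (int k) x \<in> F (Suc n)"
    proof (cases "x \<in> ?R")
      case True
      then have "\<exists>\<^sub>\<infinity>k::nat. act (int k) x \<in> F n \<inter> G n" by (simp add: recurrent_points_def)
      then show ?thesis by (rule INFM_mono) (use R True in \<open>auto simp: F_simps step_def\<close>)
    next
      case False
      then have "\<not> (\<exists>\<^sub>\<infinity>k::nat. act (int k) x \<in> F n \<inter> G n)" using x by (simp add: recurrent_points_def)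
      then have "\<forall>\<^sub>\<infinity>k::nat. act (int k) x \<notin> F n \<inter> G n" by (simp add: not_frequently)
      with inf have "\<exists>\<^sub>\<infinity>k::nat. act (int k) x \<in> F n \<and> act (int k) x \<notin> F n \<inter> G n"
        by (simp add: frequently_eventually_frequently)
      then show ?thesis by (rule INFM_mono) (use R False in \<open>auto simp: F_simps step_def\<close>)
    qed
    then show ?case using x by (simp add: recurrent_points_def)
  qed
  have "k = 0" if "x \<in> (\<Inter>n. F n)" "act k x \<in> (\<Inter>n. F n)" for x k
  proof -
    have x: "x \<in> space M" using that(1) F_simps(1) by blast
    have "x \<in> G n \<longleftrightarrow> act k x \<in> G n" for n
    proof -
      have "x \<in> F (Suc n)" "act k x \<in> F (Suc n)" using that by blast+
      then show ?thesis using recurrent_points_act_iff[OF x] by (auto simp: F_simps step_def)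
    qed
    then have "act k x = x" using separating[of x "act k x"] x act_in by metis
    then show ?thesis by (rule act_free[OF x])
  qed
  with dec F_sets rec that show thesis by (simp add: recurrent_points_def)
qed

text \<open>The hypothesis on I says that it meets each orbit at most once, and at one time
  only.\<close>

lemma finite_orbit_visits:
  assumes x: "x \<in> space M" and I: "\<And>y k. \<lbrakk>y \<in> I; act k y \<in> I\<rbrakk> \<Longrightarrow> k = 0"
  shows "finite {k. act (int k) x \<in> I}"
proof (rule finite_subset)
  let ?k = "SOME k :: nat. act (int k) x \<in> I"
  show "{k. act (int k) x \<in> I} \<subseteq> {?k}"
  proof
    fix k assume "k \<in> {k. act (int k) x \<in> I}"
    then have k: "act (int k) x \<in> I" by simp
    then have "act (int ?k) x \<in> I" by (rule someI)
    moreover have "act (int k) x = act (int k - int ?k) (act (int ?k) x)"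
      using act_add[OF x] by simp
    ultimately have "int k - int ?k = 0" using I k by metis
    then show "k \<in> {?k}" by simp
  qed
qed simp

text \<open>I and J take away finitely many times; time 0 is discarded with them to make k
  positive.\<close>

lemma INFM_avoid:
  assumes "x \<in> space M" "\<exists>\<^sub>\<infinity>k::nat. act (int k) x \<in> B"
    and "\<And>y k. \<lbrakk>y \<in> I; act k y \<in> I\<rbrakk> \<Longrightarrow> k = 0" "\<And>y k. \<lbrakk>y \<in> J; act k y \<in> J\<rbrakk> \<Longrightarrow> k = 0"
  shows "\<exists>k\<ge>1. act (int k) x \<in> B - (I \<union> J)"
proof -
  have "finite ({k. act (int k) x \<in> I} \<union> {k. act (int k) x \<in> J} \<union> {0})"
    using finite_orbit_visits[OF assms(1)] assms(3,4) by simp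
  with assms(2) have "infinite ({k. act (int k) x \<in> B} -
      ({k. act (int k) x \<in> I} \<union> {k. act (int k) x \<in> J} \<union> {0}))"
    by (simp add: frequently_cofinite Diff_infinite_finite)
  then obtain k where "k \<in> {k. act (int k) x \<in> B} -
      ({k. act (int k) x \<in> I} \<union> {k. act (int k) x \<in> J} \<union> {0})"
    by (metis finite.emptyI ex_in_conv)
  then show ?thesis by (intro exI[of _ k]) auto
qed

lemma aperiodic_borel_action_reverse: "aperiodic_borel_action M (\<lambda>k. act (- k))"
  by unfold_locales (auto simp: act_0 act_add act_measurable add.commute dest: act_free)

text \<open>The sets F recur forward and, by time reversal, the sets H recur backward; their unions
  recur both ways. What survives in either intersection meets each orbit at most once, so it can be
  removed without spoiling recurrence.\<close>

lemma vanishing_markers: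
  assumes G: "\<And>n. G n \<in> sets M"
    and separating: "\<And>x y. \<lbrakk>x \<in> space M; y \<in> space M; \<And>n :: nat. x \<in> G n \<longleftrightarrow> y \<in> G n\<rbrakk> \<Longrightarrow> x = y"
  obtains A where "A 0 = space M" "decseq A" "(\<Inter>n. A n) = {}" "\<And>n. A n \<in> sets M"
    and "\<And>n x. x \<in> space M \<Longrightarrow> \<exists>k\<ge>1. act (int k) x \<in> A n"
    and "\<And>n x. x \<in> space M \<Longrightarrow> \<exists>k. act (- int k) x \<in> A n"
proof -
  interpret rev: aperiodic_borel_action M "\<lambda>k. act (- k)" by (rule aperiodic_borel_action_reverse)
  obtain F where F: "decseq F" "\<And>n. F n \<in> sets M"
    "\<And>n x. x \<in> space M \<Longrightarrow> \<exists>\<^sub>\<infinity>k::nat. act (int k) x \<in> F n"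
    "\<And>x k. \<lbrakk>x \<in> (\<Inter>n. F n); act k x \<in> (\<Inter>n. F n)\<rbrakk> \<Longrightarrow> k = 0"
    using forward_markers[of G] G separating by blast
  obtain H where H: "decseq H" "\<And>n. H n \<in> sets M"
    "\<And>n x. x \<in> space M \<Longrightarrow> \<exists>\<^sub>\<infinity>k::nat. act (- int k) x \<in> H n"
    "\<And>x k. \<lbrakk>x \<in> (\<Inter>n. H n); act (- k) x \<in> (\<Inter>n. H n)\<rbrakk> \<Longrightarrow> k = 0"
    using rev.forward_markers[of G] G separating by blast
  have H4: "k = 0" if "x \<in> (\<Inter>n. H n)" "act k x \<in> (\<Inter>n. H n)" for x k
    using H(4)[of x "- k"] that by simp
  have F4: "k = 0" if "x \<in> (\<Inter>n. F n)" "act (- k) x \<in> (\<Inter>n. F n)" for x k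
    using F(4)[of x "- k"] that by simp
  define I where "I = (\<Inter>n. F n) \<union> (\<Inter>n. H n)"
  define A where "A n = (if n = 0 then space M else (F n \<union> H n) - I)" for n
  have sub: "(F n \<union> H n) - I \<subseteq> A n" for n
    using F(2)[of n] H(2)[of n] sets.sets_into_space by (auto simp: A_def)
  show thesis
  proof (rule that[of A])
    show "A 0 = space M" by (simp add: A_def)
    show "decseq A"
    proof (rule decseq_SucI)
      fix n
      have "F (Suc n) \<subseteq> F n" "H (Suc n) \<subseteq> H n" using F(1) H(1) by (auto simp: decseq_Suc_iff)
      moreover have "F (Suc n) \<union> H (Suc n) \<subseteq> space M" using F(2) H(2) sets.sets_into_space by blast
      ultimately show "A (Suc n) \<subseteq> A n" by (auto simp: A_def)
    qed
    show "A n \<in> sets M" for n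
      using F(2) H(2) unfolding A_def I_def by (auto intro!: sets.Diff sets.Un sets.countable_INT)
    show "(\<Inter>n. A n) = {}"
    proof (rule ccontr)
      assume "(\<Inter>n. A n) \<noteq> {}"
      then obtain x where x: "\<And>n. x \<in> A n" by blast
      \<comment> \<open>The index is shifted because \<open>A 0\<close> was reset to the whole space
        and says nothing about I. A point outside I leaves both decreasing sequences at some
        stage.\<close>
      have "x \<notin> I" and FH: "x \<in> F (Suc n) \<or> x \<in> H (Suc n)" for n
        using x[of "Suc n"] by (auto simp: A_def)
      then obtain i j where ij: "x \<notin> F i" "x \<notin> H j" by (auto simp: I_def)
      have "F (Suc (max i j)) \<subseteq> F i" "H (Suc (max i j)) \<subseteq> H j"
        using decseqD[OF F(1), of i "Suc (max i j)"] decseqD[OF H(1), of j "Suc (max i j)"] by simp_all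
      with ij FH[of "max i j"] show False by blast
    qed
    show "\<exists>k\<ge>1. act (int k) x \<in> A n" if x: "x \<in> space M" for n x
    proof -
      have "\<exists>k\<ge>1. act (int k) x \<in> F n - I"
        unfolding I_def by (rule INFM_avoid[OF x F(3)[OF x]]) (fact F(4), fact H4)
      then show ?thesis using sub[of n] by blast
    qed
    show "\<exists>k. act (- int k) x \<in> A n" if x: "x \<in> space M" for n x
    proof -
      have "\<exists>k\<ge>1. act (- int k) x \<in> H n - I"
        unfolding I_def by (rule rev.INFM_avoid[OF x H(3)[OF x]]) (fact F4, fact H(4))
      then show ?thesis using sub[of n] by blast
    qed
  qed
qed

end

section \<open>Integer powers of an automorphism\<close>

definition int_iterate :: "'a set \<Rightarrow> ('a \<Rightarrow> 'a) \<Rightarrow> int \<Rightarrow> 'a \<Rightarrow> 'a" where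
  "int_iterate X T i = (if i \<ge> 0 then T ^^ nat i else the_inv_into X T ^^ nat (- i))"

lemma int_iterate_simps:
  "int_iterate X T (int n) = T ^^ n" "int_iterate X T (- int n) = the_inv_into X T ^^ n"
  by (auto simp: int_iterate_def)

context
  fixes X :: "'a set" and T :: "'a \<Rightarrow> 'a"
  assumes bij: "bij_betw T X X"
begin

lemma int_iterate_in: "x \<in> X \<Longrightarrow> int_iterate X T i x \<in> X"
proof -
  have "(T ^^ n) x \<in> X" "(the_inv_into X T ^^ n) x \<in> X" if "x \<in> X" for x n
    using that bij_betwE[OF bij] bij_betwE[OF bij_betw_the_inv_into[OF bij]] by (induction n) auto
  then show "x \<in> X \<Longrightarrow> int_iterate X T i x \<in> X" by (simp add: int_iterate_def)
qed

lemma int_iterate_plus_1: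
  assumes x: "x \<in> X"
  shows "int_iterate X T (i + 1) x = T (int_iterate X T i x)"
proof (cases i rule: int_cases)
  case (nonneg n)
  then have "i + 1 = int (Suc n)" by simp
  with nonneg show ?thesis by (simp only: int_iterate_simps funpow.simps o_apply)
next
  case (neg n)
  then have "i + 1 = - int n" by simp
  then have "int_iterate X T (i + 1) x = (the_inv_into X T ^^ n) x"
    by (simp only: int_iterate_simps)
  moreover have "(the_inv_into X T ^^ n) x \<in> X"
    using int_iterate_in[OF x, of "- int n"] by (simp only: int_iterate_simps)
  ultimately show ?thesis
    using f_the_inv_into_f_bij_betw[OF bij] unfolding neg int_iterate_simps by simp
qed

lemma int_iterate_minus_1:
  assumes x: "x \<in> X"
  shows "int_iterate X T (i - 1) x = the_inv_into X T (int_iterate X T i x)"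
  using int_iterate_plus_1[OF x, of "i - 1"] int_iterate_in[OF x, of "i - 1"]
    the_inv_into_f_f[OF bij_betw_imp_inj_on[OF bij]] by simp

lemma int_iterate_add:
  assumes x: "x \<in> X"
  shows "int_iterate X T i (int_iterate X T j x) = int_iterate X T (i + j) x"
proof (induction i rule: int_induct[where k = 0])
  case base
  show ?case by (simp add: int_iterate_def)
next
  case (step1 i)
  then show ?case
    using int_iterate_plus_1[OF int_iterate_in[OF x, of j], of i] int_iterate_plus_1[OF x, of "i + j"]
    by (simp add: algebra_simps)
next
  case (step2 i)
  then show ?case
    using int_iterate_minus_1[OF int_iterate_in[OF x, of j], of i] int_iterate_minus_1[OF x, of "i + j"]
    by (simp add: algebra_simps)
qed

text \<open>A nonzero period k would let every iterate be reduced modulo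
  \<open>\<bar>k\<bar>\<close>, leaving a finite orbit.\<close>

lemma int_iterate_free:
  assumes x: "x \<in> X" and ap: "infinite (full_orbit X T x)" and k: "int_iterate X T k x = x"
  shows "k = 0"
proof (rule ccontr)
  assume "k \<noteq> 0"
  have mult: "int_iterate X T (int n * k) x = x" for n
  proof (induction n)
    case (Suc n)
    then show ?case using int_iterate_add[OF x, of k "int n * k"] k by (simp add: algebra_simps)
  qed (simp add: int_iterate_def)
  \<comment> \<open>Multiples of both signs occur, since the quotient of i by
    \<open>\<bar>k\<bar>\<close> may be negative.\<close>
  have mult': "int_iterate X T (j * \<bar>k\<bar>) x = x" for j
  proof -
    define n where "n = nat \<bar>j\<bar>"
    have n: "j * \<bar>k\<bar> = int n * k \<or> j * \<bar>k\<bar> = - (int n * k)"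
      by (auto simp: n_def abs_if)
    have "int_iterate X T (- (int n * k)) (int_iterate X T (int n * k) x) = x"
      unfolding int_iterate_add[OF x] by (simp add: int_iterate_def)
    with n mult show ?thesis by auto
  qed
  have orbit: "int_iterate X T i x \<in> (\<lambda>j. int_iterate X T j x) ` {0..<\<bar>k\<bar>}" for i
  proof
    show "int_iterate X T i x = int_iterate X T (i mod \<bar>k\<bar>) x"
      using int_iterate_add[OF x, of "i mod \<bar>k\<bar>" "i div \<bar>k\<bar> * \<bar>k\<bar>"] mult' by simp
    show "i mod \<bar>k\<bar> \<in> {0..<\<bar>k\<bar>}" using \<open>k \<noteq> 0\<close> by simp
  qed
  have "full_orbit X T x =
      range (\<lambda>n. int_iterate X T (int n) x) \<union> range (\<lambda>n. int_iterate X T (- int n) x)"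
    by (simp only: full_orbit_def int_iterate_simps)
  also have "\<dots> \<subseteq> (\<lambda>j. int_iterate X T j x) ` {0..<\<bar>k\<bar>}"
    by (intro Un_least image_subsetI orbit)
  finally have "full_orbit X T x \<subseteq> (\<lambda>j. int_iterate X T j x) ` {0..<\<bar>k\<bar>}" .
  with ap show False using finite_subset by blast
qed

end

lemma aperiodic_borel_action_int_iterate:
  assumes "borel_automorphism M T" "aperiodic (space M) T"
  shows "aperiodic_borel_action M (int_iterate (space M) T)"
proof
  have bij: "bij_betw T (space M) (space M)"
    and T: "T \<in> M \<rightarrow>\<^sub>M M" "the_inv_into (space M) T \<in> M \<rightarrow>\<^sub>M M"
    using assms(1) by (auto simp: borel_automorphism_def borel_isomorphism_def)
  show "int_iterate (space M) T 0 x = x" for x by (simp add: int_iterate_def)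
  show "int_iterate (space M) T i (int_iterate (space M) T j x) = int_iterate (space M) T (i + j) x"
    if "x \<in> space M" for i j x
    by (rule int_iterate_add[OF bij that])
  have "f ^^ n \<in> M \<rightarrow>\<^sub>M M" if "f \<in> M \<rightarrow>\<^sub>M M" for f and n :: nat
    using that by (induction n) (auto simp: id_def intro: measurable_comp)
  with T show "int_iterate (space M) T i \<in> M \<rightarrow>\<^sub>M M" for i by (simp add: int_iterate_def)
  show "k = 0" if "x \<in> space M" "int_iterate (space M) T k x = x" for k x
    using int_iterate_free[OF bij that(1) _ that(2)] assms(2) that(1) by (simp add: aperiodic_def)
qed

section \<open>Complete codings\<close>

text \<open>A sequence in J stands for a union that truth assignments have to respect. Constant
  sequences serve to put a single set into the domain.\<close>

definition join_dom :: "(nat \<Rightarrow> 'a set) set \<Rightarrow> 'a set set" where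
  "join_dom J = (\<Union>s\<in>J. insert (\<Union>n. s n) (range s))"

text \<open>A truth assignment \<open>t\<close> plays the role of the family of sets containing an ideal point: it is
  pairwise consistent and respects each of the countable unions listed in \<open>J\<close>.\<close>

definition generic :: "'a set \<Rightarrow> (nat \<Rightarrow> 'a set) set \<Rightarrow> ('a set \<Rightarrow> bool) \<Rightarrow> bool" where
  "generic X J t \<longleftrightarrow>
     (\<forall>A\<in>join_dom J. \<forall>B\<in>join_dom J. \<exists>x\<in>X. (t A \<longleftrightarrow> x \<in> A) \<and> (t B \<longleftrightarrow> x \<in> B)) \<and>
     (\<forall>s\<in>J. t (\<Union>n. s n) \<longrightarrow> (\<exists>n. t (s n)))"

lemma join_dom_mono: "J \<subseteq> K \<Longrightarrow> join_dom J \<subseteq> join_dom K"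
  by (auto simp: join_dom_def)

lemma generic_antimono: "\<lbrakk>generic X K t; J \<subseteq> K\<rbrakk> \<Longrightarrow> generic X J t"
  unfolding generic_def by (meson join_dom_mono subsetD)

lemma join_dom_const: "(\<lambda>_. A) \<in> J \<Longrightarrow> A \<in> join_dom J"
  unfolding join_dom_def by (rule UN_I) auto

lemma join_dom_union: "s \<in> J \<Longrightarrow> (\<Union>n. s n) \<in> join_dom J"
  and join_dom_member: "s \<in> J \<Longrightarrow> s n \<in> join_dom J"
  by (auto simp: join_dom_def)

lemma generic_pair:
  assumes "generic X J t" "A \<in> join_dom J" "B \<in> join_dom J"
  obtains x where "x \<in> X" "t A \<longleftrightarrow> x \<in> A" "t B \<longleftrightarrow> x \<in> B"
  using assms unfolding generic_def by blast

lemma generic_join: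
  assumes "generic X J t" "s \<in> J" "t (\<Union>n. s n)"
  obtains n where "t (s n)"
  using assms unfolding generic_def by blast

section \<open>Borel sets decided by countably many unions in a Polish metric space\<close>

locale polish_metric = Metric_space X d for X :: "'a set" and d +
  fixes q :: "nat \<Rightarrow> 'a"
  assumes complete: mcomplete
    and dense: "\<lbrakk>x \<in> X; r > 0\<rbrakk> \<Longrightarrow> \<exists>k. x \<in> mcball (q k) r"
begin

text \<open>The balls are closed so that the limit of the centres of accepted balls stays in each of
  these balls.\<close>

definition net :: "nat \<Rightarrow> nat \<Rightarrow> 'a set" where
  "net n k = mcball (q k) (inverse (real (Suc n)))"

text \<open>Not an accumulation point of a set: p is an actual point described by t at every
  scale.\<close>

definition limit_point :: "('a set \<Rightarrow> bool) \<Rightarrow> 'a \<Rightarrow> bool" where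
  "limit_point t p \<longleftrightarrow> p \<in> X \<and> (\<forall>n. \<exists>k. t (net n k) \<and> p \<in> net n k)"

lemma net_subset: "net n k \<subseteq> X"
  by (auto simp: net_def)

lemma Union_net: "(\<Union>k. net n k) = X"
  using net_subset dense[of _ "inverse (real (Suc n))"] unfolding net_def by (auto simp del: in_mcball)

lemma net_dist:
  assumes "x \<in> net n k" "y \<in> net n k"
  shows "d x y \<le> 2 * inverse (real (Suc n))"
  using assms triangle''[of x "q k" y] by (auto simp: net_def)

lemma small_net: assumes "\<epsilon> > 0" obtains n where "2 * inverse (real (Suc n)) < \<epsilon>"
  using reals_Archimedean[of "\<epsilon> / 2"] assms by (auto simp: field_simps)

text \<open>Genericity picks an accepted ball of every radius. Two accepted balls intersect by
  pairwise consistency, so the centres form a Cauchy sequence.\<close>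

lemma limit_point_exists:
  assumes t: "generic X (range net) t"
  shows "\<exists>p. limit_point t p"
proof -
  have "\<exists>k. t (net n k)" for n
  proof -
    \<comment> \<open>Pairwise consistency forces t to accept the whole space, which is the union of
      the balls of any given radius.\<close>
    have "X \<in> join_dom (range net)" using join_dom_union[of "net n"] Union_net by auto
    then have "t (\<Union>k. net n k)" unfolding Union_net by (metis t generic_pair)
    then show ?thesis using generic_join[OF t] by blast
  qed
  then obtain k where k: "\<And>n. t (net n (k n))" by metis
  let ?r = "\<lambda>n. inverse (real (Suc n))"
  have q: "q (k n) \<in> X" and close: "d (q (k m)) (q (k n)) \<le> ?r m + ?r n" for m n
  proof -
    have "net m (k m) \<in> join_dom (range net)" "net n (k n) \<in> join_dom (range net)"
      by (auto intro: join_dom_member)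
    then obtain x where "x \<in> X" "x \<in> net m (k m)" "x \<in> net n (k n)"
      using generic_pair[OF t] k by metis
    then show "q (k n) \<in> X" "d (q (k m)) (q (k n)) \<le> ?r m + ?r n"
      using triangle'[of "q (k m)" x "q (k n)"] by (auto simp: net_def)
  qed
  have "MCauchy (\<lambda>n. q (k n))"
    unfolding MCauchy_def
  proof (intro conjI allI impI)
    show "range (\<lambda>n. q (k n)) \<subseteq> X" using q by auto
    fix \<epsilon> :: real assume "\<epsilon> > 0"
    then obtain N where N: "2 * ?r N < \<epsilon>" by (rule small_net)
    have "d (q (k m)) (q (k n)) < \<epsilon>" if "N \<le> m" "N \<le> n" for m n
    proof -
      have "?r m \<le> ?r N" "?r n \<le> ?r N" using that by (auto intro!: le_imp_inverse_le)
      with close[of m n] N show ?thesis by linarith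
    qed
    then show "\<exists>N. \<forall>n n'. N \<le> n \<longrightarrow> N \<le> n' \<longrightarrow> d (q (k n)) (q (k n')) < \<epsilon>" by blast
  qed
  then obtain p where p: "limitin mtopology (\<lambda>n. q (k n)) p sequentially"
    using complete by (auto simp: mcomplete_def)
  then have pX: "p \<in> X" by (simp add: limitin_metric)
  have "d (q (k n)) p \<le> ?r n" for n
  proof (rule field_le_epsilon)
    fix \<epsilon> :: real assume e: "\<epsilon> > 0"
    then obtain M where M: "\<And>m. m \<ge> M \<Longrightarrow> d (q (k m)) p < \<epsilon> / 2"
      using p unfolding limitin_metric eventually_sequentially by (metis half_gt_zero)
    obtain N where N: "2 * ?r N < \<epsilon>" using e by (rule small_net)
    let ?m = "max M N"
    have "?r ?m \<le> ?r N" by (auto intro!: le_imp_inverse_le)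
    moreover have "d (q (k n)) p \<le> d (q (k n)) (q (k ?m)) + d (q (k ?m)) p"
      using triangle q pX by blast
    ultimately show "d (q (k n)) p \<le> ?r n + \<epsilon>"
      using close[of n ?m] M[OF max.cobounded1, of N] N e by linarith
  qed
  then have "p \<in> net n (k n)" for n using q pX by (simp add: net_def)
  with k pX show ?thesis unfolding limit_point_def by blast
qed

text \<open>Otherwise some ball around p misses C, while a smaller accepted ball of the net contains
  p and has to meet the accepted set C.\<close>

lemma limit_point_in_closed:
  assumes t: "generic X J t" and J: "range net \<subseteq> J" and lim: "limit_point t p"
    and C: "closedin mtopology C" "C \<in> join_dom J" "t C"
  shows "p \<in> C"
proof (rule ccontr)
  assume "p \<notin> C"
  with C(1) lim obtain r where r: "r > 0" "disjnt C (mball p r)"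
    unfolding closedin_metric limit_point_def by blast
  obtain n where n: "2 * inverse (real (Suc n)) < r" using r(1) by (rule small_net)
  obtain k where k: "t (net n k)" "p \<in> net n k" using lim unfolding limit_point_def by blast
  have "net n k \<in> join_dom J" using J by (intro join_dom_member) auto
  then obtain x where "x \<in> C" "x \<in> net n k" using generic_pair[OF t C(2)] C(3) k(1) by metis
  with net_dist[OF k(2), of x] n r(2) k(2) show False
    using net_subset by (fastforce simp: disjnt_iff)
qed

text \<open>The balls of the net ensure that a generic assignment describes a point. Countability of
  J and Borel members of its domain allow the sets occurring in J to be treated in turn.\<close>

definition decides :: "(nat \<Rightarrow> 'a set) set \<Rightarrow> 'a set \<Rightarrow> bool" where
  "decides J A \<longleftrightarrow> countable J \<and> range net \<subseteq> J \<and> A \<in> join_dom J \<and>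
     join_dom J \<subseteq> sigma_sets X {U. openin mtopology U} \<and>
     (\<forall>t p. generic X J t \<longrightarrow> limit_point t p \<longrightarrow> (t A \<longleftrightarrow> p \<in> A))"

lemma sigma_sets_closed: "closedin mtopology C \<Longrightarrow> C \<in> sigma_sets X {U. openin mtopology U}"
proof -
  assume C: "closedin mtopology C"
  then have "openin mtopology (X - C)" by (simp add: closedin_def)
  then have "X - (X - C) \<in> sigma_sets X {U. openin mtopology U}"
    by (intro sigma_sets.Compl sigma_sets.Basic) simp
  moreover have "X - (X - C) = C" using closedin_subset[OF C] by auto
  ultimately show ?thesis by simp
qed

lemma join_dom_net: "join_dom (range net) \<subseteq> sigma_sets X {U. openin mtopology U}"
proof -
  have "net n k \<in> sigma_sets X {U. openin mtopology U}" for n k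
    by (simp add: net_def sigma_sets_closed)
  then show ?thesis
    by (auto simp: join_dom_def Union_net intro: sigma_sets_top)
qed

text \<open>An open set is a countable union of closed sets \<open>C n\<close>: acceptance of U
  passes to some \<open>C n\<close>, rejection passes to the closed complement, and accepted closed
  sets contain the point. The constant sequences put U and its complement into the domain.\<close>

lemma decides_open:
  assumes U: "openin mtopology U"
  shows "\<exists>J. decides J U"
proof -
  let ?S = "sigma_sets X {U. openin mtopology U}"
  have "fsigma_in mtopology U"
    using U by (intro open_imp_fsigma_in) (auto simp: metrizable_space_mtopology)
  then obtain C where
      C_all: "(\<forall>n. closedin mtopology (C n)) \<and> (\<forall>n. C n \<subseteq> C (Suc n)) \<and> \<Union> (range C) = U"
    unfolding fsigma_in_ascending by (rule exE)
  have C: "closedin mtopology (C n)" for n using C_all by simp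
  have CU: "(\<Union>n. C n) = U" using C_all by simp
  define J where "J = range net \<union> {C, \<lambda>_. U, \<lambda>_. X - U}"
  have XU: "closedin mtopology (X - U)" using U by (simp add: openin_closedin_eq)
  have dom: "U \<in> join_dom J" "X - U \<in> join_dom J" "C n \<in> join_dom J" for n
    by (auto simp: J_def intro: join_dom_const join_dom_member)
  have "join_dom J \<subseteq> ?S"
  proof -
    have "join_dom J = join_dom (range net) \<union> insert U (range C) \<union> {U, X - U}"
      using CU by (auto simp: join_dom_def J_def)
    then show ?thesis
      using join_dom_net sigma_sets_closed XU C U by (auto intro: sigma_sets.Basic)
  qed
  moreover have "t U \<longleftrightarrow> p \<in> U" if t: "generic X J t" and lim: "limit_point t p" for t p
  proof
    assume "t U"
    then obtain n where "t (C n)" using generic_join[OF t, of C] CU by (auto simp: J_def)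
    with limit_point_in_closed[OF t _ lim C dom(3)] have "p \<in> C n" by (auto simp: J_def)
    with CU show "p \<in> U" by blast
  next
    assume p: "p \<in> U"
    show "t U"
    proof (rule ccontr)
      assume "\<not> t U"
      then have "t (X - U)" using generic_pair[OF t dom(1,2)] by (metis DiffI)
      with limit_point_in_closed[OF t _ lim XU dom(2)] p show False by (auto simp: J_def)
    qed
  qed
  ultimately have "decides J U"
    unfolding decides_def using dom(1) by (auto simp: J_def)
  then show ?thesis by blast
qed

text \<open>For a complement the constant sequence is added, and pairwise consistency makes t
  reverse its verdict. For a union the sequence itself is added: genericity gives one direction,
  pairwise consistency the other.\<close>

lemma decides_sigma_sets:
  assumes "A \<in> sigma_sets X {U. openin mtopology U}"
  shows "\<exists>J. decides J A"
  using assms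
proof induction
  case (Basic A)
  then show ?case using decides_open by blast
next
  case Empty
  show ?case by (rule decides_open) simp
next
  case (Compl A)
  then obtain J where J: "decides J A" by blast
  define K where "K = insert (\<lambda>_. X - A) J"
  have dom: "join_dom K = insert (X - A) (join_dom J)" by (auto simp: K_def join_dom_def)
  have "t (X - A) \<longleftrightarrow> p \<in> X - A" if t: "generic X K t" and lim: "limit_point t p" for t p
  proof -
    have "t A \<longleftrightarrow> p \<in> A"
      using J generic_antimono[OF t, of J] lim by (auto simp: decides_def K_def)
    moreover have "t (X - A) \<longleftrightarrow> \<not> t A"
      using generic_pair[OF t, of A "X - A"] J by (metis DiffD2 DiffI decides_def dom insertCI)
    ultimately show ?thesis using lim by (auto simp: limit_point_def)
  qed
  then have "decides K (X - A)"
    using J Compl.hyps dom unfolding decides_def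
    by (auto simp: K_def intro: sigma_sets.Compl)
  then show ?case by blast
next
  case (Union a)
  then obtain J where J: "\<And>n. decides (J n) (a n)" by metis
  define K where "K = insert a (\<Union>n. J n)"
  have dom: "join_dom K = insert (\<Union>n. a n) (\<Union>n. join_dom (J n))"
  proof -
    have "range a \<subseteq> (\<Union>n. join_dom (J n))" using J by (auto simp: decides_def)
    moreover have "join_dom K = insert (\<Union>n. a n) (range a) \<union> (\<Union>n. join_dom (J n))"
      by (auto simp: K_def join_dom_def)
    ultimately show ?thesis by (simp only: Un_insert_left Un_absorb1)
  qed
  have "t (\<Union>n. a n) \<longleftrightarrow> p \<in> (\<Union>n. a n)" if t: "generic X K t" and lim: "limit_point t p" for t p
  proof -
    have a: "t (a n) \<longleftrightarrow> p \<in> a n" for n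
      using J[of n] generic_antimono[OF t, of "J n"] lim by (auto simp: decides_def K_def)
    have "t (\<Union>n. a n) \<longleftrightarrow> (\<exists>n. t (a n))"
    proof
      assume "t (\<Union>n. a n)"
      then show "\<exists>n. t (a n)" using generic_join[OF t, of a] by (auto simp: K_def)
    next
      assume "\<exists>n. t (a n)"
      then obtain n where n: "t (a n)" by blast
      have "a n \<in> join_dom K" "(\<Union>n. a n) \<in> join_dom K"
        using J[of n] dom by (auto simp: decides_def)
      then obtain x where "t (a n) \<longleftrightarrow> x \<in> a n" "t (\<Union>n. a n) \<longleftrightarrow> x \<in> (\<Union>n. a n)"
        using generic_pair[OF t] by metis
      with n show "t (\<Union>n. a n)" by blast
    qed
    with a show ?thesis by auto
  qed
  moreover have "join_dom K \<subseteq> sigma_sets X {U. openin mtopology U}"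
    unfolding dom using J Union.hyps by (auto simp: decides_def intro: sigma_sets.Union)
  moreover have "countable K"
    using J by (auto simp: decides_def K_def)
  moreover have "range net \<subseteq> J 0" "J 0 \<subseteq> K"
    using J[of 0] by (auto simp: decides_def K_def)
  then have "range net \<subseteq> K" by (rule subset_trans)
  ultimately have "decides K (\<Union>n. a n)"
    using dom unfolding decides_def by simp
  then show ?case by blast
qed

lemma net_separating:
  assumes "x \<in> X" "y \<in> X" "\<And>n k. x \<in> net n k \<longleftrightarrow> y \<in> net n k"
  shows "x = y"
proof (rule ccontr)
  assume "x \<noteq> y"
  then obtain n where n: "2 * inverse (real (Suc n)) < d x y"
    using small_net[of "d x y"] mdist_pos_less assms(1,2) by metis
  obtain k where "x \<in> net n k" using Union_net assms(1) by blast
  with net_dist[of x n k y] assms(3) n show False by force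
qed

lemma open_Union_net:
  assumes "openin mtopology U" shows "\<exists>I. U = (\<Union>(n, k)\<in>I. net n k)"
proof (intro exI subset_antisym subsetI)
  fix x assume x: "x \<in> U"
  then obtain r where r: "r > 0" "mball x r \<subseteq> U" "x \<in> X"
    using assms unfolding openin_mtopology by blast
  obtain n where n: "2 * inverse (real (Suc n)) < r" using r(1) by (rule small_net)
  obtain k where k: "x \<in> net n k" using Union_net r(3) by blast
  have "net n k \<subseteq> U"
    using r net_subset[of n k] net_dist[OF k] n by fastforce
  with k show "x \<in> (\<Union>(n, k)\<in>{(n, k). net n k \<subseteq> U}. net n k)" by blast
qed auto

text \<open>Every open set is a union of balls of the net, and there are only countably many of
  these.\<close>

lemma net_generates:
  "sigma_sets X {U. openin mtopology U} \<subseteq> sigma_sets X (range (\<lambda>(n, k). net n k))"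
proof (rule sigma_sets_mono, rule subsetI)
  fix U assume "U \<in> {U. openin mtopology U}"
  then obtain I where I: "U = (\<Union>(n, k)\<in>I. net n k)" using open_Union_net by blast
  have sub: "range (\<lambda>(n, k). net n k) \<subseteq> Pow X" using net_subset by auto
  interpret sigma_algebra X "sigma_sets X (range (\<lambda>(n, k). net n k))"
    by (rule sigma_algebra_sigma_sets[OF sub])
  show "U \<in> sigma_sets X (range (\<lambda>(n, k). net n k))"
    unfolding I by (rule countable_UN') (auto intro: countableI_type sigma_sets.Basic)
qed

end

section \<open>Countable families of Borel sets closed under deciding unions and translation\<close>

locale polish_action =
  polish_metric "space M" d q + aperiodic_borel_action M act
  for M :: "'a measure" and d q act +
  assumes sets_eq: "sets M = sigma_sets (space M) {U. openin mtopology U}"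
begin

definition joins_for :: "'a set \<Rightarrow> (nat \<Rightarrow> 'a set) set" where
  "joins_for A = (SOME J. decides J A)"

lemma decides_joins_for: "A \<in> sets M \<Longrightarrow> decides (joins_for A) A"
  unfolding joins_for_def sets_eq by (rule someI_ex) (rule decides_sigma_sets)

lemma countable_join_dom: "countable J \<Longrightarrow> countable (join_dom J)"
  unfolding join_dom_def by (intro countable_UN) auto

text \<open>The sets of \<open>joins_for A\<close> are added so that they get decided too, the
  preimages so that the action becomes continuous for the topology of the code.\<close>

definition saturation_step :: "'a set set \<Rightarrow> 'a set set" where
  "saturation_step D = D \<union> (\<Union>A\<in>D. join_dom (joins_for A)) \<union>
     (\<Union>i. (\<lambda>A. act i -` A \<inter> space M) ` D)"

lemma saturation_step_countable:
  assumes "countable D" "D \<subseteq> sets M"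
  shows "countable (saturation_step D)" "saturation_step D \<subseteq> sets M"
proof -
  have *: "countable (join_dom (joins_for A))" "join_dom (joins_for A) \<subseteq> sets M" if "A \<in> D" for A
    using decides_joins_for[of A] that assms(2) by (auto simp: decides_def sets_eq countable_join_dom)
  show "countable (saturation_step D)"
    unfolding saturation_step_def using assms(1) *(1)
    by (intro countable_Un countable_UN countable_image) auto
  show "saturation_step D \<subseteq> sets M"
    unfolding saturation_step_def using assms(2) *(2) measurable_sets[OF act_measurable] by blast
qed

definition saturation :: "'a set set \<Rightarrow> 'a set set" where
  "saturation D = (\<Union>n. (saturation_step ^^ n) D)"

lemma saturation_countable:
  assumes "countable D" "D \<subseteq> sets M"
  shows "countable (saturation D)" "saturation D \<subseteq> sets M"
proof -
  have "countable ((saturation_step ^^ n) D) \<and> (saturation_step ^^ n) D \<subseteq> sets M" for n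
    using assms saturation_step_countable by (induction n) auto
  then show "countable (saturation D)" "saturation D \<subseteq> sets M"
    by (auto simp: saturation_def)
qed

lemma saturation_superset: "D \<subseteq> saturation D"
  unfolding saturation_def using UN_upper[of 0 UNIV "\<lambda>n. (saturation_step ^^ n) D"] by simp

text \<open>Each closure operation applies to one set at a time, so countably many rounds
  suffice.\<close>

lemma saturation_closed:
  assumes "A \<in> saturation D"
  shows "join_dom (joins_for A) \<subseteq> saturation D" "act i -` A \<inter> space M \<in> saturation D"
proof -
  obtain n where n: "A \<in> (saturation_step ^^ n) D" using assms by (auto simp: saturation_def)
  have "saturation_step ((saturation_step ^^ n) D) \<subseteq> saturation D"
    unfolding saturation_def using UN_upper[of "Suc n" UNIV "\<lambda>n. (saturation_step ^^ n) D"] by simp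
  moreover have "join_dom (joins_for A) \<subseteq> saturation_step ((saturation_step ^^ n) D)"
    and "act i -` A \<inter> space M \<in> saturation_step ((saturation_step ^^ n) D)"
    using n by (auto simp: saturation_step_def)
  ultimately show "join_dom (joins_for A) \<subseteq> saturation D" "act i -` A \<inter> space M \<in> saturation D"
    by auto
qed

text \<open>After saturation the domain of J is exactly the family E from which J was built, so one
  described point settles every set of the domain.\<close>

lemma saturated_joins_exist:
  assumes D: "countable D" "D \<subseteq> sets M" "D \<noteq> {}"
  obtains J where "countable J" "D \<subseteq> join_dom J" "join_dom J \<subseteq> sets M"
    and "\<And>A. A \<in> join_dom J \<Longrightarrow> (\<lambda>_. A) \<in> J"
    and "\<And>A i. A \<in> join_dom J \<Longrightarrow> act i -` A \<inter> space M \<in> join_dom J"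
    and "\<And>t. generic (space M) J t \<Longrightarrow> \<exists>p\<in>space M. \<forall>A\<in>join_dom J. t A \<longleftrightarrow> p \<in> A"
proof -
  define E where "E = saturation D"
  note E = saturation_countable[OF D(1,2), folded E_def]
  define J where "J = (\<Union>A\<in>E. insert (\<lambda>_. A) (joins_for A))"
  have dec: "decides (joins_for A) A" if "A \<in> E" for A
    using decides_joins_for E(2) that by blast
  have "join_dom J = (\<Union>A\<in>E. insert A (join_dom (joins_for A)))"
    by (auto simp: J_def join_dom_def)
  also have "\<dots> = E" using saturation_closed(1) by (auto simp: E_def)
  finally have dom: "join_dom J = E" .
  have "D \<subseteq> E" unfolding E_def by (rule saturation_superset)
  show thesis
  proof (rule that)
    show "countable J"
      unfolding J_def using E(1) dec by (auto simp: decides_def)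
    show "D \<subseteq> join_dom J" unfolding dom by fact
    show "join_dom J \<subseteq> sets M" unfolding dom by (rule E(2))
    show "(\<lambda>_. A) \<in> J" if "A \<in> join_dom J" for A using that unfolding dom by (auto simp: J_def)
    show "act i -` A \<inter> space M \<in> join_dom J" if "A \<in> join_dom J" for A i
      using that saturation_closed(2) unfolding dom E_def by blast
    fix t assume t: "generic (space M) J t"
    have tA: "generic (space M) (joins_for A) t" if "A \<in> E" for A
      using that by (intro generic_antimono[OF t]) (auto simp: J_def)
    \<comment> \<open>Any member of E brings the net into J, which yields the described
      point.\<close>
    obtain A0 where A0: "A0 \<in> E" using D(3) \<open>D \<subseteq> E\<close> by auto
    then have "generic (space M) (range net) t"
      using dec[OF A0] generic_antimono[OF tA[OF A0]] by (simp add: decides_def)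
    then obtain p where p: "limit_point t p" using limit_point_exists by blast
    then have "\<forall>A\<in>E. t A \<longleftrightarrow> p \<in> A" using dec tA unfolding decides_def by blast
    with p show "\<exists>p\<in>space M. \<forall>A\<in>join_dom J. t A \<longleftrightarrow> p \<in> A"
      unfolding dom limit_point_def by blast
  qed
qed

end

section \<open>Codes by least witnesses\<close>

locale saturated_joins =
  fixes M :: "'a measure" and act :: "int \<Rightarrow> 'a \<Rightarrow> 'a" and A :: "nat \<Rightarrow> 'a set"
    and S :: "nat \<Rightarrow> nat \<Rightarrow> 'a set"
  assumes act_in: "x \<in> space M \<Longrightarrow> act i x \<in> space M"
    and A_dom: "A n \<in> join_dom (range S)" and A_0: "A 0 = space M"
    and dom_sets: "join_dom (range S) \<subseteq> sets M"
    and dom_const: "B \<in> join_dom (range S) \<Longrightarrow> \<exists>i. S i = (\<lambda>_. B)"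
    and dom_act: "B \<in> join_dom (range S) \<Longrightarrow> act i -` B \<inter> space M \<in> join_dom (range S)"
    and realized: "generic (space M) (range S) t \<Longrightarrow>
      \<exists>p\<in>space M. \<forall>B\<in>join_dom (range S). t B \<longleftrightarrow> p \<in> B"
begin

text \<open>The value 0 marks points outside the union. For a constant sequence only 0 and 1 occur,
  so the witness is an indicator function.\<close>

definition witness :: "'a \<Rightarrow> nat \<Rightarrow> nat" where
  "witness x i = (if x \<in> (\<Union>m. S i m) then Suc (LEAST m. x \<in> S i m) else 0)"

text \<open>The markers run up to index n inclusive, since \<open>code n\<close> has to determine
  \<open>A n\<close>. At n = 0 only membership in \<open>A 0\<close> is recorded, which is constant
  on the space.\<close>

definition code :: "nat \<Rightarrow> 'a \<Rightarrow> nat" where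
  "code n x = to_nat (map (witness x) [0..<n], map (\<lambda>i. x \<in> A i) [0..<Suc n])"

lemma witness_eq_0: "witness x i = 0 \<longleftrightarrow> (\<forall>m. x \<notin> S i m)"
  by (simp add: witness_def)

lemma witness_eq_Suc: "witness x i = Suc m \<longleftrightarrow> x \<in> S i m \<and> (\<forall>l<m. x \<notin> S i l)"
proof
  assume "witness x i = Suc m"
  then have ex: "\<exists>m. x \<in> S i m" and m: "m = (LEAST m. x \<in> S i m)"
    by (auto simp: witness_def split: if_splits)
  have "x \<in> S i m" unfolding m by (rule LeastI_ex[OF ex])
  moreover have "x \<notin> S i l" if "l < m" for l using that unfolding m by (rule not_less_Least)
  ultimately show "x \<in> S i m \<and> (\<forall>l<m. x \<notin> S i l)" by blast
next
  assume *: "x \<in> S i m \<and> (\<forall>l<m. x \<notin> S i l)"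
  then have "(LEAST m. x \<in> S i m) = m" by (intro Least_equality) (auto simp: not_less[symmetric])
  with * show "witness x i = Suc m" by (auto simp: witness_def)
qed

lemma code_eq_iff:
  "code n x = code n y \<longleftrightarrow> (\<forall>i<n. witness x i = witness y i) \<and> (\<forall>i\<le>n. x \<in> A i \<longleftrightarrow> y \<in> A i)"
  by (auto simp: code_def less_Suc_eq_le simp del: upt_Suc)

lemma dom_index:
  assumes "B \<in> join_dom (range S)"
  obtains i where "\<And>x. x \<in> B \<longleftrightarrow> witness x i \<noteq> 0"
  using dom_const[OF assms] that by (metis witness_eq_0)

text \<open>P holds on a neighbourhood of x in the topology whose basic sets are the classes of
  equal code.\<close>

definition near :: "'a \<Rightarrow> ('a \<Rightarrow> bool) \<Rightarrow> bool" where
  "near x P \<longleftrightarrow> (\<exists>m. \<forall>z\<in>space M. code m z = code m x \<longrightarrow> P z)"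

lemma code_antimono: "\<lbrakk>m \<le> n; code n x = code n y\<rbrakk> \<Longrightarrow> code m x = code m y"
  unfolding code_eq_iff by auto

lemma near_conj: "\<lbrakk>near x P; near x Q\<rbrakk> \<Longrightarrow> near x (\<lambda>z. P z \<and> Q z)"
  unfolding near_def by (meson code_antimono nat_le_linear)

lemma near_all_less:
  fixes n :: nat
  assumes "\<And>i. i < n \<Longrightarrow> near x (P i)" shows "near x (\<lambda>z. \<forall>i<n. P i z)"
  using assms
proof (induction n)
  case (Suc n)
  then have "near x (\<lambda>z. (\<forall>i<n. P i z) \<and> P n z)" by (intro near_conj) auto
  then show ?case unfolding near_def by (auto simp: less_Suc_eq)
qed (simp add: near_def)

lemma near_mono: "\<lbrakk>near x P; \<And>z. z \<in> space M \<Longrightarrow> P z \<Longrightarrow> Q z\<rbrakk> \<Longrightarrow> near x Q"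
  unfolding near_def by blast

lemma near_dom:
  assumes "B \<in> join_dom (range S)" shows "near x (\<lambda>z. z \<in> B \<longleftrightarrow> x \<in> B)"
proof -
  obtain i where i: "\<And>x. x \<in> B \<longleftrightarrow> witness x i \<noteq> 0" using dom_index[OF assms] by blast
  then have "z \<in> B \<longleftrightarrow> x \<in> B" if "code (Suc i) z = code (Suc i) x" for z
    using that by (simp add: code_eq_iff)
  then show ?thesis unfolding near_def by blast
qed

lemma near_dom_act:
  assumes "B \<in> join_dom (range S)" "x \<in> space M"
  shows "near x (\<lambda>z. act i z \<in> B \<longleftrightarrow> act i x \<in> B)"
  by (rule near_mono[OF near_dom[OF dom_act[OF assms(1), of i]]]) (use assms(2) in auto)

lemma S_dom: "S i m \<in> join_dom (range S)" "(\<Union>m. S i m) \<in> join_dom (range S)"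
  by (auto intro: join_dom_member join_dom_union)

text \<open>The witness 0 depends on the single set \<open>\<Union>m. S l m\<close>, a witness
  \<open>Suc m\<close> on the finitely many sets \<open>S l 0\<close> to \<open>S l m\<close>; all
  of them belong to the domain and have clopen preimages.\<close>

lemma near_witness_act:
  assumes x: "x \<in> space M"
  shows "near x (\<lambda>z. witness (act i z) l = witness (act i x) l)"
proof (cases "witness (act i x) l")
  case 0
  show ?thesis
    unfolding 0 witness_eq_0
    by (rule near_mono[OF near_dom_act[OF S_dom(2)[of l] x, of i]])
      (use 0[unfolded witness_eq_0] in auto)
next
  case (Suc m)
  have "near x (\<lambda>z. \<forall>k<Suc m. act i z \<in> S l k \<longleftrightarrow> act i x \<in> S l k)"
    by (intro near_all_less near_dom_act S_dom x)
  then show ?thesis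
    unfolding Suc witness_eq_Suc
    by (rule near_mono) (use Suc[unfolded witness_eq_Suc] in \<open>auto simp: less_Suc_eq\<close>)
qed

lemma code_act:
  assumes x: "x \<in> space M"
  shows "\<exists>m. \<forall>z\<in>space M. code m z = code m x \<longrightarrow> code n (act i z) = code n (act i x)"
proof -
  have "near x (\<lambda>z. (\<forall>l<n. witness (act i z) l = witness (act i x) l) \<and>
      (\<forall>l<Suc n. act i z \<in> A l \<longleftrightarrow> act i x \<in> A l))"
    by (intro near_conj near_all_less near_witness_act near_dom_act A_dom x)
  then show ?thesis
    unfolding near_def code_eq_iff by (simp add: less_Suc_eq_le)
qed

text \<open>Eventual membership along the sequence is a generic assignment: pairs are tested at a
  late member, and a stabilized nonzero witness names an accepted member of the union. The point
  realizing this assignment is the limit.\<close>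

lemma code_complete:
  assumes xs: "\<And>m. xs m \<in> space M" and cauchy: "\<And>m n. n \<le> m \<Longrightarrow> code n (xs m) = code n (xs n)"
  shows "\<exists>x\<in>space M. \<forall>n. code n x = code n (xs n)"
proof -
  define t where "t B \<longleftrightarrow> (\<exists>N. \<forall>m\<ge>N. xs m \<in> B)" for B
  have w: "witness (xs m) i = witness (xs (Suc i)) i" if "Suc i \<le> m" for m i
    using cauchy[OF that] by (simp add: code_eq_iff)
  have stable: "\<exists>N. \<forall>m\<ge>N. t B \<longleftrightarrow> xs m \<in> B" if B: "B \<in> join_dom (range S)" for B
  proof -
    obtain i where i: "\<And>x. x \<in> B \<longleftrightarrow> witness x i \<noteq> 0" using dom_index[OF B] by blast
    then have "xs m \<in> B \<longleftrightarrow> xs (Suc i) \<in> B" if "Suc i \<le> m" for m using w[OF that] by simp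
    then show ?thesis unfolding t_def by (metis nat_le_linear)
  qed
  \<comment> \<open>The stabilized witness fixes membership in \<open>S i k\<close> from index
    \<open>Suc i\<close> on only for k up to the least witness. If the witness is 0, m is free and k
    is arbitrary.\<close>
  have tS: "t (S i k) \<longleftrightarrow> xs (Suc i) \<in> S i k"
    if "witness (xs (Suc i)) i = 0 \<or> witness (xs (Suc i)) i = Suc m" "k \<le> m" for i k m
  proof -
    obtain N where N: "\<And>m. m \<ge> N \<Longrightarrow> t (S i k) \<longleftrightarrow> xs m \<in> S i k" using stable[OF S_dom(1)] by blast
    have "witness (xs (max N (Suc i))) i = witness (xs (Suc i)) i" by (rule w) simp
    then have "xs (max N (Suc i)) \<in> S i k \<longleftrightarrow> xs (Suc i) \<in> S i k"
      using that by (metis le_eq_less_or_eq witness_eq_0 witness_eq_Suc)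
    with N[of "max N (Suc i)"] show ?thesis by simp
  qed
  have "generic (space M) (range S) t"
    unfolding generic_def
  proof (intro conjI ballI impI)
    fix B C assume "B \<in> join_dom (range S)" "C \<in> join_dom (range S)"
    then obtain N N' where "\<forall>m\<ge>N. t B \<longleftrightarrow> xs m \<in> B" "\<forall>m\<ge>N'. t C \<longleftrightarrow> xs m \<in> C"
      using stable by metis
    then have "(t B \<longleftrightarrow> xs (max N N') \<in> B) \<and> (t C \<longleftrightarrow> xs (max N N') \<in> C)" by simp
    with xs show "\<exists>x\<in>space M. (t B \<longleftrightarrow> x \<in> B) \<and> (t C \<longleftrightarrow> x \<in> C)" by blast
  next
    fix s assume "s \<in> range S" and ts: "t (\<Union>n. s n)"
    then obtain i where s: "s = S i" by blast
    from ts obtain N where "\<And>m. m \<ge> N \<Longrightarrow> xs m \<in> (\<Union>n. S i n)" unfolding t_def s by blast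
    then have "xs (max N (Suc i)) \<in> (\<Union>n. S i n)" by simp
    then have "witness (xs (max N (Suc i))) i \<noteq> 0" by (auto simp: witness_eq_0)
    then have "witness (xs (Suc i)) i \<noteq> 0" using w[of i "max N (Suc i)"] by simp
    then obtain m where m: "witness (xs (Suc i)) i = Suc m" by (metis not0_implies_Suc)
    then have "t (S i m)" using tS[of i m m] by (simp add: witness_eq_Suc)
    then show "\<exists>n. t (s n)" using s by blast
  qed
  from realized[OF this]
  obtain p where p: "p \<in> space M" "\<And>B. B \<in> join_dom (range S) \<Longrightarrow> t B \<longleftrightarrow> p \<in> B" by blast
  have "witness p i = witness (xs (Suc i)) i" for i
  proof (cases "witness (xs (Suc i)) i")
    case 0
    then have "p \<notin> S i k" for k using tS[of i k k] p(2)[OF S_dom(1)] by (simp add: witness_eq_0)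
    then have "witness p i = 0" by (simp add: witness_eq_0)
    with 0 show ?thesis by simp
  next
    case (Suc m)
    then have "p \<in> S i k \<longleftrightarrow> xs (Suc i) \<in> S i k" if "k \<le> m" for k
      using tS[of i m k] p(2)[OF S_dom(1)] that by simp
    with Suc have "witness p i = Suc m" by (simp add: witness_eq_Suc)
    with Suc show ?thesis by simp
  qed
  moreover have "p \<in> A i \<longleftrightarrow> xs n \<in> A i" if "i \<le> n" for i n
  proof -
    obtain N where N: "\<And>m. m \<ge> N \<Longrightarrow> t (A i) \<longleftrightarrow> xs m \<in> A i" using stable[OF A_dom] by blast
    have "xs (max N n) \<in> A i \<longleftrightarrow> xs n \<in> A i"
      using cauchy[of n "max N n"] that by (simp add: code_eq_iff)
    with N[of "max N n"] p(2)[OF A_dom] show ?thesis by simp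
  qed
  moreover have "witness (xs n) i = witness (xs (Suc i)) i" if "i < n" for i n
    using w[of i n] that by simp
  ultimately have "code n p = code n (xs n)" for n
    unfolding code_eq_iff by metis
  with p(1) show ?thesis by blast
qed

lemma code_measurable: "code n \<in> M \<rightarrow>\<^sub>M count_space UNIV"
proof -
  have S: "S i m \<in> sets M" and A: "A i \<in> sets M" for i m using dom_sets S_dom(1) A_dom by blast+
  have S': "{x \<in> space M. x \<in> S i m} \<in> sets M" and A': "{x \<in> space M. x \<in> A i} \<in> sets M" for i m
    using sets.Int[OF sets.top S] sets.Int[OF sets.top A] by (simp_all add: Int_def)
  have wit: "{x \<in> space M. witness x i = v} \<in> sets M" for i v
  proof (cases v)
    case 0
    then show ?thesis unfolding 0 witness_eq_0
      by (intro sets.sets_Collect_countable_All sets.sets_Collect_neg S')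
  next
    case (Suc m)
    show ?thesis unfolding Suc witness_eq_Suc
      by (intro sets.sets_Collect_countable_All sets.sets_Collect_conj sets.sets_Collect_imp
          sets.sets_Collect_neg sets.sets_Collect_const S')
  qed
  have "code n -` {j} \<inter> space M \<in> sets M" for j
  proof (cases "code n -` {j} \<inter> space M = {}")
    case False
    then obtain y where "code n y = j" by blast
    then have "code n -` {j} \<inter> space M = {x \<in> space M. code n x = code n y}" by auto
    also have "\<dots> = {x \<in> space M. (\<forall>i. i < n \<longrightarrow> witness x i = witness y i) \<and>
        (\<forall>i. i \<le> n \<longrightarrow> x \<in> A i \<longleftrightarrow> y \<in> A i)}"
      unfolding code_eq_iff ..
    also have "\<dots> \<in> sets M"
    proof -
      have "{x \<in> space M. x \<in> A i \<longleftrightarrow> y \<in> A i} \<in> sets M" for i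
        using A'[of i] sets.sets_Collect_neg[OF A'[of i]] by (cases "y \<in> A i") simp_all
      then show ?thesis
        by (intro sets.sets_Collect_countable_All sets.sets_Collect_conj sets.sets_Collect_imp
            sets.sets_Collect_const wit)
    qed
    finally show ?thesis .
  qed simp
  then show ?thesis by (simp add: measurable_count_space_eq2_countable)
qed

text \<open>Equal values of \<open>code (Suc i)\<close> give equal verdicts on B, so B is a union of
  code classes, countable because codes are natural numbers.\<close>

lemma code_generates_dom:
  assumes B: "B \<in> join_dom (range S)"
  shows "B \<in> sigma_sets (space M) {{x \<in> space M. code n x = j} |n j. True}" (is "_ \<in> sigma_sets _ ?G")
proof -
  obtain i where i: "\<And>x. x \<in> B \<longleftrightarrow> witness x i \<noteq> 0" using dom_index[OF B] by blast
  have sub: "B \<subseteq> space M" using B dom_sets sets.sets_into_space by blast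
  have "B = (\<Union>j\<in>code (Suc i) ` B. {x \<in> space M. code (Suc i) x = j})"
    using sub by (auto simp: i code_eq_iff)
  also have "\<dots> \<in> sigma_sets (space M) ?G"
  proof -
    interpret sigma_algebra "space M" "sigma_sets (space M) ?G"
      by (rule sigma_algebra_sigma_sets) auto
    show ?thesis by (rule countable_UN') (auto intro: countableI_type sigma_sets.Basic)
  qed
  finally show ?thesis .
qed

end

section \<open>The main theorem\<close>

lemma standard_borel_polish_metric:
  assumes "standard_borel_space M" "space M \<noteq> {}"
  obtains d q where "polish_metric (space M) d q"
    and "sets M = sigma_sets (space M) {U. openin (Metric_space.mtopology (space M) d) U}"
proof -
  obtain S where S: "completely_metrizable_space S" "separable_space S" "topspace S = space M"
      "sets (borel_of S) = sets M"
    using assms(1) by (auto simp: standard_borel_space_def polish_space_def)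
  obtain X d where X: "Metric_space X d" "Metric_space.mcomplete X d" "S = Metric_space.mtopology X d"
    using S(1) by (auto simp: completely_metrizable_space_def)
  interpret Metric_space X d by (rule X(1))
  have XM: "X = space M" using S(3) X(3) by simp
  obtain C where C: "countable C" "C \<subseteq> X" "mtopology closure_of C = X"
    using S(2) X(3) by (auto simp: separable_space_def)
  \<comment> \<open>Only a nonempty countable set is the range of
    \<open>from_nat_into\<close>.\<close>
  then have "C \<noteq> {}" using assms(2) XM by auto
  then have q: "range (from_nat_into C) = C" using C(1) by (rule range_from_nat_into)
  have "\<exists>k. x \<in> mcball (from_nat_into C k) r" if x: "x \<in> X" and "r > 0" for x r
  proof -
    have "x \<in> mtopology closure_of C" using C(3) x by simp
    then obtain y where "y \<in> C" "y \<in> mcball x r"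
      unfolding metric_closure_of_alt using \<open>r > 0\<close> by auto
    moreover from \<open>y \<in> C\<close> q obtain k where "y = from_nat_into C k" by blast
    ultimately show ?thesis by (auto simp: commute)
  qed
  then have "polish_metric X d (from_nat_into C)"
    using X(2) by unfold_locales auto
  moreover have "sets M = sigma_sets X {U. openin mtopology U}"
    using S(4) X(3) by (simp add: sets_borel_of)
  ultimately show thesis using that unfolding XM by blast
qed

theorem theorem4p3:
  fixes M :: "'a measure" and T :: "'a \<Rightarrow> 'a"
  assumes "standard_borel_space M"
    and "uncountable (space M)"
    and "borel_automorphism M T"
    and "aperiodic (space M) T"
  shows "\<exists>B :: (nat, nat) ordered_diagram.
           ordered_borel_bratteli_diagram B \<and>
           isomorphic_systems M T (borel_of (path_topology B)) (vershik B)"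
proof -
  have ne: "space M \<noteq> {}" using assms(2) by auto
  obtain d q where polish: "polish_metric (space M) d q"
      "sets M = sigma_sets (space M) {U. openin (Metric_space.mtopology (space M) d) U}"
    using standard_borel_polish_metric[OF assms(1) ne] by blast
  let ?act = "int_iterate (space M) T"
  interpret polish_metric "space M" d q by (rule polish(1))
  interpret aperiodic_borel_action M ?act
    by (rule aperiodic_borel_action_int_iterate[OF assms(3,4)])
  interpret polish_action M d q ?act
    by unfold_locales (rule polish(2))
  define G where "G n = (case prod_decode n of (i, k) \<Rightarrow> net i k)" for n
  have range_G: "range G = range (\<lambda>(i, k). net i k)"
  proof -
    have "range G = (\<lambda>(i, k). net i k) ` range prod_decode"
      unfolding G_def by (simp add: image_image)
    then show ?thesis by (simp add: surj_prod_decode)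
  qed
  have net_G: "net i k = G (prod_encode (i, k))" for i k by (simp add: G_def)
  have G_sets: "G n \<in> sets M" for n
    by (simp add: G_def sets_eq net_def sigma_sets_closed split: prod.split)
  have G_sep: "x = y" if "x \<in> space M" "y \<in> space M" "\<And>n. x \<in> G n \<longleftrightarrow> y \<in> G n" for x y
    using that by (intro net_separating) (auto simp: net_G)
  obtain A where A: "A 0 = space M" "decseq A" "(\<Inter>n. A n) = {}" "\<And>n. A n \<in> sets M"
      "\<And>n x. x \<in> space M \<Longrightarrow> \<exists>k\<ge>1. ?act (int k) x \<in> A n"
      "\<And>n x. x \<in> space M \<Longrightarrow> \<exists>k. ?act (- int k) x \<in> A n"
    by (rule vanishing_markers[OF G_sets G_sep]) (assumption | rule that; assumption)+
  \<comment> \<open>Starting the saturation from the balls makes the code separate points and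
    generate the Borel sets; starting it from the markers makes them clopen along with their
    translates.\<close>
  have "countable (range G \<union> range A)" "range G \<union> range A \<subseteq> sets M" "range G \<union> range A \<noteq> {}"
    using G_sets A(4) by auto
  then obtain J where J: "countable J" "range G \<union> range A \<subseteq> join_dom J" "join_dom J \<subseteq> sets M"
    "\<And>B. B \<in> join_dom J \<Longrightarrow> (\<lambda>_. B) \<in> J"
    "\<And>B i. B \<in> join_dom J \<Longrightarrow> ?act i -` B \<inter> space M \<in> join_dom J"
    "\<And>t. generic (space M) J t \<Longrightarrow> \<exists>p\<in>space M. \<forall>B\<in>join_dom J. t B \<longleftrightarrow> p \<in> B"
    by (rule saturated_joins_exist) (rule that; assumption)
  have "J \<noteq> {}" using J(2) by (auto simp: join_dom_def)
  define S where "S = from_nat_into J"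
  have S: "range S = J" unfolding S_def using \<open>J \<noteq> {}\<close> J(1) by (rule range_from_nat_into)
  interpret saturated_joins M ?act A S
  proof
    show "A n \<in> join_dom (range S)" for n using J(2) S by auto
    show "\<exists>i. S i = (\<lambda>_. B)" if "B \<in> join_dom (range S)" for B
      using J(4)[of B] that S by (metis rangeE)
  qed (use act_in A(1) J(3,5,6) S in auto)
  have G_dom: "G n \<in> join_dom (range S)" for n using J(2) S by auto
  interpret borel_marked_coding M ?act A code
  proof
    show "code n x = code n y" if "code (Suc n) x = code (Suc n) y" for n x y
      using that by (rule code_antimono[rotated]) simp
    show "x = y" if xy: "x \<in> space M" "y \<in> space M" and eq: "\<And>n. code n x = code n y" for x y
    proof (rule G_sep[OF xy])
      fix n
      obtain i where i: "\<And>x. x \<in> G n \<longleftrightarrow> witness x i \<noteq> 0" using dom_index[OF G_dom] by blast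
      show "x \<in> G n \<longleftrightarrow> y \<in> G n" using eq[of "Suc i"] by (simp add: i code_eq_iff)
    qed
    show "sets M \<subseteq> sigma_sets (space M) {{x \<in> space M. code n x = j} |n j. True}"
    proof -
      have "sets M \<subseteq> sigma_sets (space M) (range G)"
        unfolding sets_eq range_G by (rule net_generates)
      also have "\<dots> \<subseteq> sigma_sets (space M) {{x \<in> space M. code n x = j} |n j. True}"
        by (rule sigma_sets_mono) (use code_generates_dom[OF G_dom] in blast)
      finally show ?thesis .
    qed
  qed (use A act_0 act_add act_in act_measurable code_act code_complete code_measurable in
      \<open>auto simp: code_eq_iff\<close>)
  have "T x = ?act 1 x" for x by (simp add: int_iterate_def)
  then have "isomorphic_systems M T (borel_of (path_topology diag)) (vershik diag)"
    by (rule isomorphic_systems_diag)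
  with ordered_borel_bratteli_diagram_diag[OF ne] show ?thesis by blast
qed

end
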